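(* Let $\mathcal{C}$ and $\mathcal{D}$ be monoidal categories and let $R\colon\mathcal{C}\to\mathcal{D}$ be a monoidal functor with left adjoint $L$. Assume that $\mathcal{C}$ has coequalizers which are preserved by $\otimes$ and that the forgetful functor $|-|\colon\mathbf{Mon}\,\mathcal{C}\to\mathcal{C}$ has a left adjoint $T$. Then the induced functor $\bar{R}\colon\mathbf{Mon}\,\mathcal{C}\to\mathbf{Mon}\,\mathcal{D}$ has a left adjoint.
   Context: $\mathbf{Mon}\,\mathcal{C}$ is the category of monoids in the monoidal category $\mathcal{C}$ and monoid morphisms, and $|-|$ sends a monoid to its underlying object. "$\otimes$ preserves coequalizers" in $\mathcal{C}$ means that for each object $C$ of $\mathcal{C}$ the functors $C\otimes -$ and $-\otimes C$ preserve coequalizers. A monoidal functor $R$ is a lax monoidal functor: it comes with a natural transformation $\Phi_{A,B}\colon RA\otimes RB\to R(A\otimes B)$ and a morphism $\phi\colon I_{\mathcal{D}}\to RI_{\mathcal{C}}$ satisfying the usual coherence axioms (not required to be invertible). The induced functor $\bar{R}$ sends a monoid $(A,m_A,e_A)$ to $(RA,\,Rm_A\circ\Phi_{A,A},\,Re_A\circ\phi)$ and acts on morphisms as $R$, so that it commutes with $R$ and the forgetful functors. *)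

theory Defs
  imports Main
begin

text \<open>A category is given by explicit carriers of objects and arrows. The operations are
  unconstrained outside the carriers, so no statement below compares functors or
  transformations off the carriers. Composition is in the classical order:
  \<open>g \<cdot> f\<close> is defined when the codomain of \<open>f\<close> is the domain of \<open>g\<close>.\<close>

record ('o, 'a) category =
  Obj :: "'o set"
  Arr :: "'a set"
  Dom :: "'a \<Rightarrow> 'o"
  Cod :: "'a \<Rightarrow> 'o"
  Idn :: "'o \<Rightarrow> 'a"
  Comp :: "'a \<Rightarrow> 'a \<Rightarrow> 'a" (infixl "\<cdot>\<index>" 70)

definition Hom :: "('o, 'a, 'm) category_scheme \<Rightarrow> 'o \<Rightarrow> 'o \<Rightarrow> 'a set" where
  "Hom C a b = {f \<in> Arr C. Dom C f = a \<and> Cod C f = b}"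

locale category =
  fixes C :: "('o, 'a, 'm) category_scheme" (structure)
  assumes Dom_Obj: "f \<in> Arr C \<Longrightarrow> Dom C f \<in> Obj C"
    and Cod_Obj: "f \<in> Arr C \<Longrightarrow> Cod C f \<in> Obj C"
    and Idn_Hom: "a \<in> Obj C \<Longrightarrow> Idn C a \<in> Hom C a a"
    and Comp_Hom: "\<lbrakk>f \<in> Hom C a b; g \<in> Hom C b c\<rbrakk> \<Longrightarrow> g \<cdot> f \<in> Hom C a c"
    and Idn_left: "f \<in> Hom C a b \<Longrightarrow> Idn C b \<cdot> f = f"
    and Idn_right: "f \<in> Hom C a b \<Longrightarrow> f \<cdot> Idn C a = f"
    and Comp_assoc: "\<lbrakk>f \<in> Hom C a b; g \<in> Hom C b c; h \<in> Hom C c d\<rbrakk>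
      \<Longrightarrow> (h \<cdot> g) \<cdot> f = h \<cdot> (g \<cdot> f)"

definition iso_in :: "('o, 'a, 'm) category_scheme \<Rightarrow> 'o \<Rightarrow> 'o \<Rightarrow> 'a \<Rightarrow> bool" where
  "iso_in C a b f \<longleftrightarrow> f \<in> Hom C a b \<and>
    (\<exists>g \<in> Hom C b a. g \<cdot>\<^bsub>C\<^esub> f = Idn C a \<and> f \<cdot>\<^bsub>C\<^esub> g = Idn C b)"

definition is_coequalizer :: "('o, 'a, 'm) category_scheme \<Rightarrow> 'a \<Rightarrow> 'a \<Rightarrow> 'a \<Rightarrow> bool" where
  "is_coequalizer C f g q \<longleftrightarrow>
    (\<exists>a b c. f \<in> Hom C a b \<and> g \<in> Hom C a b \<and> q \<in> Hom C b c \<and> q \<cdot>\<^bsub>C\<^esub> f = q \<cdot>\<^bsub>C\<^esub> g \<and>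
      (\<forall>d. \<forall>h \<in> Hom C b d. h \<cdot>\<^bsub>C\<^esub> f = h \<cdot>\<^bsub>C\<^esub> g \<longrightarrow> (\<exists>!k. k \<in> Hom C c d \<and> k \<cdot>\<^bsub>C\<^esub> q = h)))"

definition has_coequalizers :: "('o, 'a, 'm) category_scheme \<Rightarrow> bool" where
  "has_coequalizers C \<longleftrightarrow>
    (\<forall>a b. \<forall>f \<in> Hom C a b. \<forall>g \<in> Hom C a b. \<exists>q. is_coequalizer C f g q)"

record ('o1, 'a1, 'o2, 'a2) func =
  OMap :: "'o1 \<Rightarrow> 'o2"
  AMap :: "'a1 \<Rightarrow> 'a2"

locale is_functor = C: category C + D: category D
  for C :: "('o1, 'a1, 'm1) category_scheme" and D :: "('o2, 'a2, 'm2) category_scheme" +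
  fixes F :: "('o1, 'a1, 'o2, 'a2, 'f) func_scheme"
  assumes OMap_Obj: "a \<in> Obj C \<Longrightarrow> OMap F a \<in> Obj D"
    and AMap_Hom: "f \<in> Hom C a b \<Longrightarrow> AMap F f \<in> Hom D (OMap F a) (OMap F b)"
    and AMap_Idn: "a \<in> Obj C \<Longrightarrow> AMap F (Idn C a) = Idn D (OMap F a)"
    and AMap_Comp: "\<lbrakk>f \<in> Hom C a b; g \<in> Hom C b c\<rbrakk>
      \<Longrightarrow> AMap F (g \<cdot>\<^bsub>C\<^esub> f) = AMap F g \<cdot>\<^bsub>D\<^esub> AMap F f"

definition preserves_coequalizers ::
  "('o1, 'a1, 'm1) category_scheme \<Rightarrow> ('o2, 'a2, 'm2) category_scheme
    \<Rightarrow> ('o1, 'a1, 'o2, 'a2, 'f) func_scheme \<Rightarrow> bool" where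
  "preserves_coequalizers C D F \<longleftrightarrow>
    (\<forall>f g q. is_coequalizer C f g q \<longrightarrow> is_coequalizer D (AMap F f) (AMap F g) (AMap F q))"

text \<open>Here \<open>L : D \<rightarrow> C\<close> is left adjoint to \<open>R : C \<rightarrow> D\<close>: the first category argument is the
  codomain of the left adjoint.\<close>

locale adjunction = L: is_functor D C L + R: is_functor C D R
  for C :: "('o1, 'a1, 'm1) category_scheme" and D :: "('o2, 'a2, 'm2) category_scheme"
    and L :: "('o2, 'a2, 'o1, 'a1, 'l) func_scheme"
    and R :: "('o1, 'a1, 'o2, 'a2, 'r) func_scheme" +
  fixes \<eta> :: "'o2 \<Rightarrow> 'a2" and \<epsilon> :: "'o1 \<Rightarrow> 'a1"
  assumes unit_Hom: "x \<in> Obj D \<Longrightarrow> \<eta> x \<in> Hom D x (OMap R (OMap L x))"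
    and unit_natural: "f \<in> Hom D x y
      \<Longrightarrow> \<eta> y \<cdot>\<^bsub>D\<^esub> f = AMap R (AMap L f) \<cdot>\<^bsub>D\<^esub> \<eta> x"
    and counit_Hom: "a \<in> Obj C \<Longrightarrow> \<epsilon> a \<in> Hom C (OMap L (OMap R a)) a"
    and counit_natural: "g \<in> Hom C a b
      \<Longrightarrow> \<epsilon> b \<cdot>\<^bsub>C\<^esub> AMap L (AMap R g) = g \<cdot>\<^bsub>C\<^esub> \<epsilon> a"
    and triangle_left: "x \<in> Obj D
      \<Longrightarrow> \<epsilon> (OMap L x) \<cdot>\<^bsub>C\<^esub> AMap L (\<eta> x) = Idn C (OMap L x)"
    and triangle_right: "a \<in> Obj C
      \<Longrightarrow> AMap R (\<epsilon> a) \<cdot>\<^bsub>D\<^esub> \<eta> (OMap R a) = Idn D (OMap R a)"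

definition is_left_adjoint ::
  "('o1, 'a1, 'm1) category_scheme \<Rightarrow> ('o2, 'a2, 'm2) category_scheme
    \<Rightarrow> ('o2, 'a2, 'o1, 'a1, 'l) func_scheme \<Rightarrow> ('o1, 'a1, 'o2, 'a2, 'r) func_scheme \<Rightarrow> bool" where
  "is_left_adjoint C D L R \<longleftrightarrow> (\<exists>\<eta> \<epsilon>. adjunction C D L R \<eta> \<epsilon>)"

record ('o, 'a) monoidal = "('o, 'a) category" +
  TObj :: "'o \<Rightarrow> 'o \<Rightarrow> 'o" (infixl "\<otimes>\<^sub>o\<index>" 75)
  TArr :: "'a \<Rightarrow> 'a \<Rightarrow> 'a" (infixl "\<otimes>\<index>" 75)
  TUnit :: "'o" ("\<I>\<index>")
  Assoc :: "'o \<Rightarrow> 'o \<Rightarrow> 'o \<Rightarrow> 'a"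
  LUnit :: "'o \<Rightarrow> 'a"
  RUnit :: "'o \<Rightarrow> 'a"

locale monoidal_category = category C
  for C :: "('o, 'a, 'm) monoidal_scheme" (structure) +
  assumes TObj_Obj: "\<lbrakk>a \<in> Obj C; b \<in> Obj C\<rbrakk> \<Longrightarrow> a \<otimes>\<^sub>o b \<in> Obj C"
    and TArr_Hom: "\<lbrakk>f \<in> Hom C a b; g \<in> Hom C c d\<rbrakk>
      \<Longrightarrow> f \<otimes> g \<in> Hom C (a \<otimes>\<^sub>o c) (b \<otimes>\<^sub>o d)"
    and TArr_Idn: "\<lbrakk>a \<in> Obj C; b \<in> Obj C\<rbrakk> \<Longrightarrow> Idn C a \<otimes> Idn C b = Idn C (a \<otimes>\<^sub>o b)"
    and TArr_Comp: "\<lbrakk>f \<in> Hom C a b; g \<in> Hom C b c; f' \<in> Hom C a' b'; g' \<in> Hom C b' c'\<rbrakk>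
      \<Longrightarrow> (g \<cdot> f) \<otimes> (g' \<cdot> f') = (g \<otimes> g') \<cdot> (f \<otimes> f')"
    and TUnit_Obj: "\<I> \<in> Obj C"
    and Assoc_iso: "\<lbrakk>a \<in> Obj C; b \<in> Obj C; c \<in> Obj C\<rbrakk>
      \<Longrightarrow> iso_in C ((a \<otimes>\<^sub>o b) \<otimes>\<^sub>o c) (a \<otimes>\<^sub>o (b \<otimes>\<^sub>o c)) (Assoc C a b c)"
    and Assoc_natural: "\<lbrakk>f \<in> Hom C a a'; g \<in> Hom C b b'; h \<in> Hom C c c'\<rbrakk>
      \<Longrightarrow> Assoc C a' b' c' \<cdot> ((f \<otimes> g) \<otimes> h) = (f \<otimes> (g \<otimes> h)) \<cdot> Assoc C a b c"
    and LUnit_iso: "a \<in> Obj C \<Longrightarrow> iso_in C (\<I> \<otimes>\<^sub>o a) a (LUnit C a)"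
    and LUnit_natural: "f \<in> Hom C a b
      \<Longrightarrow> LUnit C b \<cdot> (Idn C \<I> \<otimes> f) = f \<cdot> LUnit C a"
    and RUnit_iso: "a \<in> Obj C \<Longrightarrow> iso_in C (a \<otimes>\<^sub>o \<I>) a (RUnit C a)"
    and RUnit_natural: "f \<in> Hom C a b
      \<Longrightarrow> RUnit C b \<cdot> (f \<otimes> Idn C \<I>) = f \<cdot> RUnit C a"
    and pentagon: "\<lbrakk>a \<in> Obj C; b \<in> Obj C; c \<in> Obj C; d \<in> Obj C\<rbrakk>
      \<Longrightarrow> (Idn C a \<otimes> Assoc C b c d) \<cdot> Assoc C a (b \<otimes>\<^sub>o c) d \<cdot> (Assoc C a b c \<otimes> Idn C d)
        = Assoc C a b (c \<otimes>\<^sub>o d) \<cdot> Assoc C (a \<otimes>\<^sub>o b) c d"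
    and triangle: "\<lbrakk>a \<in> Obj C; b \<in> Obj C\<rbrakk>
      \<Longrightarrow> (Idn C a \<otimes> LUnit C b) \<cdot> Assoc C a \<I> b = RUnit C a \<otimes> Idn C b"

definition tensor_left ::
  "('o, 'a, 'm) monoidal_scheme \<Rightarrow> 'o \<Rightarrow> ('o, 'a, 'o, 'a) func" where
  "tensor_left C a = \<lparr>OMap = (\<lambda>b. a \<otimes>\<^sub>o\<^bsub>C\<^esub> b), AMap = (\<lambda>f. Idn C a \<otimes>\<^bsub>C\<^esub> f)\<rparr>"

definition tensor_right ::
  "('o, 'a, 'm) monoidal_scheme \<Rightarrow> 'o \<Rightarrow> ('o, 'a, 'o, 'a) func" where
  "tensor_right C a = \<lparr>OMap = (\<lambda>b. b \<otimes>\<^sub>o\<^bsub>C\<^esub> a), AMap = (\<lambda>f. f \<otimes>\<^bsub>C\<^esub> Idn C a)\<rparr>"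

definition tensor_preserves_coequalizers :: "('o, 'a, 'm) monoidal_scheme \<Rightarrow> bool" where
  "tensor_preserves_coequalizers C \<longleftrightarrow>
    (\<forall>a \<in> Obj C. preserves_coequalizers C C (tensor_left C a) \<and>
      preserves_coequalizers C C (tensor_right C a))"

record ('o1, 'a1, 'o2, 'a2) lax_func = "('o1, 'a1, 'o2, 'a2) func" +
  LaxMult :: "'o1 \<Rightarrow> 'o1 \<Rightarrow> 'a2"
  LaxUnit :: "'a2"

locale lax_monoidal_functor =
  C: monoidal_category C + D: monoidal_category D + is_functor C D R
  for C :: "('o1, 'a1, 'm1) monoidal_scheme" and D :: "('o2, 'a2, 'm2) monoidal_scheme"
    and R :: "('o1, 'a1, 'o2, 'a2, 'f) lax_func_scheme" +
  assumes LaxMult_Hom: "\<lbrakk>a \<in> Obj C; b \<in> Obj C\<rbrakk>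
      \<Longrightarrow> LaxMult R a b \<in> Hom D (OMap R a \<otimes>\<^sub>o\<^bsub>D\<^esub> OMap R b) (OMap R (a \<otimes>\<^sub>o\<^bsub>C\<^esub> b))"
    and LaxMult_natural: "\<lbrakk>f \<in> Hom C a a'; g \<in> Hom C b b'\<rbrakk>
      \<Longrightarrow> LaxMult R a' b' \<cdot>\<^bsub>D\<^esub> (AMap R f \<otimes>\<^bsub>D\<^esub> AMap R g)
        = AMap R (f \<otimes>\<^bsub>C\<^esub> g) \<cdot>\<^bsub>D\<^esub> LaxMult R a b"
    and LaxUnit_Hom: "LaxUnit R \<in> Hom D \<I>\<^bsub>D\<^esub> (OMap R \<I>\<^bsub>C\<^esub>)"
    and lax_assoc: "\<lbrakk>a \<in> Obj C; b \<in> Obj C; c \<in> Obj C\<rbrakk>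
      \<Longrightarrow> AMap R (Assoc C a b c) \<cdot>\<^bsub>D\<^esub> LaxMult R (a \<otimes>\<^sub>o\<^bsub>C\<^esub> b) c
            \<cdot>\<^bsub>D\<^esub> (LaxMult R a b \<otimes>\<^bsub>D\<^esub> Idn D (OMap R c))
        = LaxMult R a (b \<otimes>\<^sub>o\<^bsub>C\<^esub> c) \<cdot>\<^bsub>D\<^esub> (Idn D (OMap R a) \<otimes>\<^bsub>D\<^esub> LaxMult R b c)
            \<cdot>\<^bsub>D\<^esub> Assoc D (OMap R a) (OMap R b) (OMap R c)"
    and lax_left_unit: "a \<in> Obj C
      \<Longrightarrow> AMap R (LUnit C a) \<cdot>\<^bsub>D\<^esub> LaxMult R \<I>\<^bsub>C\<^esub> a
            \<cdot>\<^bsub>D\<^esub> (LaxUnit R \<otimes>\<^bsub>D\<^esub> Idn D (OMap R a))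
        = LUnit D (OMap R a)"
    and lax_right_unit: "a \<in> Obj C
      \<Longrightarrow> AMap R (RUnit C a) \<cdot>\<^bsub>D\<^esub> LaxMult R a \<I>\<^bsub>C\<^esub>
            \<cdot>\<^bsub>D\<^esub> (Idn D (OMap R a) \<otimes>\<^bsub>D\<^esub> LaxUnit R)
        = RUnit D (OMap R a)"

record ('o, 'a) mon =
  MObj :: "'o"
  MMult :: "'a"
  MUnit :: "'a"

definition monoid_in :: "('o, 'a, 'm) monoidal_scheme \<Rightarrow> ('o, 'a) mon \<Rightarrow> bool" where
  "monoid_in C M \<longleftrightarrow>
    MObj M \<in> Obj C \<and>
    MMult M \<in> Hom C (MObj M \<otimes>\<^sub>o\<^bsub>C\<^esub> MObj M) (MObj M) \<and>
    MUnit M \<in> Hom C \<I>\<^bsub>C\<^esub> (MObj M) \<and>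
    MMult M \<cdot>\<^bsub>C\<^esub> (MMult M \<otimes>\<^bsub>C\<^esub> Idn C (MObj M))
      = MMult M \<cdot>\<^bsub>C\<^esub> (Idn C (MObj M) \<otimes>\<^bsub>C\<^esub> MMult M)
          \<cdot>\<^bsub>C\<^esub> Assoc C (MObj M) (MObj M) (MObj M) \<and>
    MMult M \<cdot>\<^bsub>C\<^esub> (MUnit M \<otimes>\<^bsub>C\<^esub> Idn C (MObj M)) = LUnit C (MObj M) \<and>
    MMult M \<cdot>\<^bsub>C\<^esub> (Idn C (MObj M) \<otimes>\<^bsub>C\<^esub> MUnit M) = RUnit C (MObj M)"

definition monoid_morphism ::
  "('o, 'a, 'm) monoidal_scheme \<Rightarrow> ('o, 'a) mon \<Rightarrow> ('o, 'a) mon \<Rightarrow> 'a \<Rightarrow> bool" where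
  "monoid_morphism C M N f \<longleftrightarrow>
    f \<in> Hom C (MObj M) (MObj N) \<and>
    f \<cdot>\<^bsub>C\<^esub> MMult M = MMult N \<cdot>\<^bsub>C\<^esub> (f \<otimes>\<^bsub>C\<^esub> f) \<and>
    f \<cdot>\<^bsub>C\<^esub> MUnit M = MUnit N"

text \<open>The same arrow can underlie morphisms between different monoids, so an arrow of the
  category of monoids carries its source and target.\<close>

record ('o, 'a) mon_arr =
  MSrc :: "('o, 'a) mon"
  MTgt :: "('o, 'a) mon"
  MMap :: "'a"

definition Mon ::
  "('o, 'a, 'm) monoidal_scheme \<Rightarrow> (('o, 'a) mon, ('o, 'a) mon_arr) category" where
  "Mon C = \<lparr>
    Obj = {M. monoid_in C M},
    Arr = {h. monoid_in C (MSrc h) \<and> monoid_in C (MTgt h) \<and>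
              monoid_morphism C (MSrc h) (MTgt h) (MMap h)},
    Dom = MSrc,
    Cod = MTgt,
    Idn = (\<lambda>M. \<lparr>MSrc = M, MTgt = M, MMap = Idn C (MObj M)\<rparr>),
    Comp = (\<lambda>k h. \<lparr>MSrc = MSrc h, MTgt = MTgt k, MMap = MMap k \<cdot>\<^bsub>C\<^esub> MMap h\<rparr>)\<rparr>"

definition forgetful :: "(('o, 'a) mon, ('o, 'a) mon_arr, 'o, 'a) func" where
  "forgetful = \<lparr>OMap = MObj, AMap = MMap\<rparr>"

definition induced_mon ::
  "('o2, 'a2, 'm2) monoidal_scheme \<Rightarrow> ('o1, 'a1, 'o2, 'a2, 'f) lax_func_scheme
    \<Rightarrow> ('o1, 'a1) mon \<Rightarrow> ('o2, 'a2) mon" where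
  "induced_mon D R M = \<lparr>
    MObj = OMap R (MObj M),
    MMult = AMap R (MMult M) \<cdot>\<^bsub>D\<^esub> LaxMult R (MObj M) (MObj M),
    MUnit = AMap R (MUnit M) \<cdot>\<^bsub>D\<^esub> LaxUnit R\<rparr>"

definition induced_functor ::
  "('o2, 'a2, 'm2) monoidal_scheme \<Rightarrow> ('o1, 'a1, 'o2, 'a2, 'f) lax_func_scheme
    \<Rightarrow> (('o1, 'a1) mon, ('o1, 'a1) mon_arr, ('o2, 'a2) mon, ('o2, 'a2) mon_arr) func" where
  "induced_functor D R = \<lparr>
    OMap = induced_mon D R,
    AMap = (\<lambda>h. \<lparr>MSrc = induced_mon D R (MSrc h), MTgt = induced_mon D R (MTgt h),
                 MMap = AMap R (MMap h)\<rparr>)\<rparr>"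

lemma Hom_Obj:
  assumes "category C" and "f \<in> Hom C a b"
  shows "a \<in> Obj C" "b \<in> Obj C"
  using assms category.Dom_Obj[OF assms(1), of f] category.Cod_Obj[OF assms(1), of f]
  by (auto simp: Hom_def)

lemma Mon_sel [simp]:
  "Obj (Mon C) = {M. monoid_in C M}"
  "Dom (Mon C) = MSrc" "Cod (Mon C) = MTgt"
  "Idn (Mon C) M = \<lparr>MSrc = M, MTgt = M, MMap = Idn C (MObj M)\<rparr>"
  "k \<cdot>\<^bsub>Mon C\<^esub> h = \<lparr>MSrc = MSrc h, MTgt = MTgt k, MMap = MMap k \<cdot>\<^bsub>C\<^esub> MMap h\<rparr>"
  by (auto simp: Mon_def)

lemma Mon_Hom:
  "h \<in> Hom (Mon C) M N \<longleftrightarrow>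
    monoid_in C M \<and> monoid_in C N \<and> MSrc h = M \<and> MTgt h = N \<and> monoid_morphism C M N (MMap h)"
  by (auto simp: Hom_def Mon_def)

context monoidal_category
begin

lemma monoid_morphism_Idn:
  assumes "monoid_in C M"
  shows "monoid_morphism C M M (Idn C (MObj M))"
  using assms Idn_Hom Idn_left[of "MMult M"] Idn_right[of "MMult M"] Idn_left[of "MUnit M"] TArr_Idn
  by (auto simp: monoid_morphism_def monoid_in_def)

lemma monoid_morphism_Comp:
  assumes "monoid_in C M" "monoid_in C N" "monoid_in C P"
    and f: "monoid_morphism C M N f" and g: "monoid_morphism C N P g"
  shows "monoid_morphism C M P (g \<cdot> f)"
proof -
  have h: "f \<in> Hom C (MObj M) (MObj N)" "g \<in> Hom C (MObj N) (MObj P)"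
    using f g by (auto simp: monoid_morphism_def)
  have m: "MMult M \<in> Hom C (MObj M \<otimes>\<^sub>o MObj M) (MObj M)"
    "MMult N \<in> Hom C (MObj N \<otimes>\<^sub>o MObj N) (MObj N)"
    "MMult P \<in> Hom C (MObj P \<otimes>\<^sub>o MObj P) (MObj P)"
    and u: "MUnit M \<in> Hom C \<I> (MObj M)"
    using assms(1-3) by (auto simp: monoid_in_def)
  have ff: "f \<otimes> f \<in> Hom C (MObj M \<otimes>\<^sub>o MObj M) (MObj N \<otimes>\<^sub>o MObj N)"
    and gg: "g \<otimes> g \<in> Hom C (MObj N \<otimes>\<^sub>o MObj N) (MObj P \<otimes>\<^sub>o MObj P)"
    using h by (auto intro: TArr_Hom)
  have "(g \<cdot> f) \<cdot> MMult M = g \<cdot> (MMult N \<cdot> (f \<otimes> f))"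
    using f Comp_assoc[OF m(1) h] by (simp add: monoid_morphism_def)
  also have "\<dots> = (MMult P \<cdot> (g \<otimes> g)) \<cdot> (f \<otimes> f)"
    using g Comp_assoc[OF ff m(2) h(2)] by (simp add: monoid_morphism_def)
  also have "\<dots> = MMult P \<cdot> ((g \<cdot> f) \<otimes> (g \<cdot> f))"
    using Comp_assoc[OF ff gg m(3)] TArr_Comp[OF h h] by simp
  finally show ?thesis
    using f g Comp_Hom[OF h] Comp_assoc[OF u h] by (simp add: monoid_morphism_def)
qed

lemma category_Mon: "category (Mon C)"
proof
  fix f assume "f \<in> Arr (Mon C)"
  then show "Dom (Mon C) f \<in> Obj (Mon C)" "Cod (Mon C) f \<in> Obj (Mon C)"
    by (auto simp: Mon_def)
next
  fix M assume "M \<in> Obj (Mon C)"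
  then show "Idn (Mon C) M \<in> Hom (Mon C) M M"
    by (simp add: Mon_Hom monoid_morphism_Idn)
next
  fix f g M N P assume "f \<in> Hom (Mon C) M N" "g \<in> Hom (Mon C) N P"
  then show "g \<cdot>\<^bsub>Mon C\<^esub> f \<in> Hom (Mon C) M P"
    by (auto simp: Mon_Hom intro: monoid_morphism_Comp)
next
  fix f M N assume "f \<in> Hom (Mon C) M N"
  then show "Idn (Mon C) N \<cdot>\<^bsub>Mon C\<^esub> f = f" "f \<cdot>\<^bsub>Mon C\<^esub> Idn (Mon C) M = f"
    by (auto simp: Mon_Hom monoid_morphism_def Idn_left Idn_right)
next
  fix f g h M N P Q
  assume "f \<in> Hom (Mon C) M N" "g \<in> Hom (Mon C) N P" "h \<in> Hom (Mon C) P Q"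
  then show "h \<cdot>\<^bsub>Mon C\<^esub> g \<cdot>\<^bsub>Mon C\<^esub> f = h \<cdot>\<^bsub>Mon C\<^esub> (g \<cdot>\<^bsub>Mon C\<^esub> f)"
    by (auto simp: Mon_Hom monoid_morphism_def intro: Comp_assoc)
qed

lemma is_functor_forgetful: "is_functor (Mon C) C forgetful"
proof -
  interpret M: category "Mon C" by (rule category_Mon)
  show ?thesis
    by unfold_locales (auto simp: forgetful_def Mon_Hom monoid_morphism_def monoid_in_def)
qed

lemma is_functor_tensor_left: "a \<in> Obj C \<Longrightarrow> is_functor C C (tensor_left C a)"
  using TArr_Comp[OF Idn_Hom Idn_Hom, of a] Idn_left[OF Idn_Hom, of a]
  by unfold_locales (auto simp: tensor_left_def TObj_Obj TArr_Hom Idn_Hom TArr_Idn Idn_left)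

lemma is_functor_tensor_right: "a \<in> Obj C \<Longrightarrow> is_functor C C (tensor_right C a)"
  using TArr_Comp[OF _ _ Idn_Hom Idn_Hom, of _ _ _ _ _ a] Idn_left[OF Idn_Hom, of a]
  by unfold_locales (auto simp: tensor_right_def TObj_Obj TArr_Hom Idn_Hom TArr_Idn Idn_left)

end

context lax_monoidal_functor
begin

lemma monoid_morphism_induced:
  assumes "monoid_in C M" "monoid_in C N" and f: "monoid_morphism C M N f"
  shows "monoid_morphism D (induced_mon D R M) (induced_mon D R N) (AMap R f)"
proof -
  let ?M = "MObj M" and ?N = "MObj N"
  have h: "f \<in> Hom C ?M ?N" using f by (simp add: monoid_morphism_def)
  have o: "?M \<in> Obj C" "?N \<in> Obj C"
    and m: "MMult M \<in> Hom C (?M \<otimes>\<^sub>o\<^bsub>C\<^esub> ?M) ?M" "MMult N \<in> Hom C (?N \<otimes>\<^sub>o\<^bsub>C\<^esub> ?N) ?N"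
    and u: "MUnit M \<in> Hom C \<I>\<^bsub>C\<^esub> ?M"
    using assms(1,2) by (auto simp: monoid_in_def)
  note P = LaxMult_Hom[OF o(1) o(1)] LaxMult_Hom[OF o(2) o(2)]
  note RR = D.TArr_Hom[OF AMap_Hom[OF h] AMap_Hom[OF h]]
  note ff = C.TArr_Hom[OF h h]
  have "AMap R f \<cdot>\<^bsub>D\<^esub> (AMap R (MMult M) \<cdot>\<^bsub>D\<^esub> LaxMult R ?M ?M)
      = AMap R (f \<cdot>\<^bsub>C\<^esub> MMult M) \<cdot>\<^bsub>D\<^esub> LaxMult R ?M ?M"
    using D.Comp_assoc[OF P(1) AMap_Hom[OF m(1)] AMap_Hom[OF h]] AMap_Comp[OF m(1) h] by simp
  also have "\<dots> = (AMap R (MMult N) \<cdot>\<^bsub>D\<^esub> AMap R (f \<otimes>\<^bsub>C\<^esub> f)) \<cdot>\<^bsub>D\<^esub> LaxMult R ?M ?M"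
    using f AMap_Comp[OF ff m(2)] by (simp add: monoid_morphism_def)
  also have "\<dots> = AMap R (MMult N) \<cdot>\<^bsub>D\<^esub> LaxMult R ?N ?N \<cdot>\<^bsub>D\<^esub> (AMap R f \<otimes>\<^bsub>D\<^esub> AMap R f)"
    using D.Comp_assoc[OF P(1) AMap_Hom[OF ff] AMap_Hom[OF m(2)]]
      D.Comp_assoc[OF RR P(2) AMap_Hom[OF m(2)]] LaxMult_natural[OF h h] by simp
  finally have 1: "AMap R f \<cdot>\<^bsub>D\<^esub> (AMap R (MMult M) \<cdot>\<^bsub>D\<^esub> LaxMult R ?M ?M) = \<dots>" .
  have 2: "AMap R f \<cdot>\<^bsub>D\<^esub> (AMap R (MUnit M) \<cdot>\<^bsub>D\<^esub> LaxUnit R) = AMap R (MUnit N) \<cdot>\<^bsub>D\<^esub> LaxUnit R"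
    using D.Comp_assoc[OF LaxUnit_Hom AMap_Hom[OF u] AMap_Hom[OF h]] AMap_Comp[OF u h] f
    by (simp add: monoid_morphism_def)
  show ?thesis
    using 1 2 AMap_Hom[OF h] by (simp add: monoid_morphism_def induced_mon_def)
qed

lemma monoid_in_induced:
  assumes M: "monoid_in C M"
  shows "monoid_in D (induced_mon D R M)"
proof -
  define a m e where "a = MObj M" and "m = MMult M" and "e = MUnit M"
  let ?A = "OMap R a" and ?P = "LaxMult R a a" and ?p = "LaxUnit R"
  let ?ida = "Idn D ?A" and ?i = "Idn C a"
  let ?aa = "a \<otimes>\<^sub>o\<^bsub>C\<^esub> a"
  have a: "a \<in> Obj C" and m: "m \<in> Hom C ?aa a" and e: "e \<in> Hom C \<I>\<^bsub>C\<^esub> a"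
    and ass: "m \<cdot>\<^bsub>C\<^esub> (m \<otimes>\<^bsub>C\<^esub> ?i) = m \<cdot>\<^bsub>C\<^esub> (?i \<otimes>\<^bsub>C\<^esub> m) \<cdot>\<^bsub>C\<^esub> Assoc C a a a"
    and lu: "m \<cdot>\<^bsub>C\<^esub> (e \<otimes>\<^bsub>C\<^esub> ?i) = LUnit C a"
    and ru: "m \<cdot>\<^bsub>C\<^esub> (?i \<otimes>\<^bsub>C\<^esub> e) = RUnit C a"
    using M by (auto simp: monoid_in_def a_def m_def e_def)
  have A: "?A \<in> Obj D" using a by (rule OMap_Obj)
  have i: "?i \<in> Hom C a a" and I: "?ida \<in> Hom D ?A ?A" and aa: "?aa \<in> Obj C"
    using a A by (auto intro: C.Idn_Hom D.Idn_Hom C.TObj_Obj)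
  have Ri: "AMap R ?i = ?ida" using a by (rule AMap_Idn)
  note P = LaxMult_Hom[OF a a]
  note Rm = AMap_Hom[OF m]
  note Re = AMap_Hom[OF e]
  note p = LaxUnit_Hom
  note Pl = LaxMult_Hom[OF aa a] and Pr = LaxMult_Hom[OF a aa]
  have as: "Assoc C a a a \<in> Hom C (?aa \<otimes>\<^sub>o\<^bsub>C\<^esub> a) (a \<otimes>\<^sub>o\<^bsub>C\<^esub> ?aa)"
    using C.Assoc_iso[OF a a a] by (simp add: iso_in_def)
  have AS: "Assoc D ?A ?A ?A \<in> Hom D (?A \<otimes>\<^sub>o\<^bsub>D\<^esub> ?A \<otimes>\<^sub>o\<^bsub>D\<^esub> ?A) (?A \<otimes>\<^sub>o\<^bsub>D\<^esub> (?A \<otimes>\<^sub>o\<^bsub>D\<^esub> ?A))"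
    using D.Assoc_iso[OF A A A] by (simp add: iso_in_def)
  note mi = C.TArr_Hom[OF m i] and im = C.TArr_Hom[OF i m]
  note P1 = D.TArr_Hom[OF P I] and oneP = D.TArr_Hom[OF I P]
  note Rmi = D.TArr_Hom[OF Rm I] and oneRm = D.TArr_Hom[OF I Rm]
  note imas = C.Comp_Hom[OF as im]
  let ?m = "AMap R m \<cdot>\<^bsub>D\<^esub> ?P" and ?e = "AMap R e \<cdot>\<^bsub>D\<^esub> ?p"
  have hm: "?m \<in> Hom D (?A \<otimes>\<^sub>o\<^bsub>D\<^esub> ?A) ?A" and he: "?e \<in> Hom D \<I>\<^bsub>D\<^esub> ?A"
    using D.Comp_Hom P Rm p Re by auto
  have left: "?m \<cdot>\<^bsub>D\<^esub> (AMap R x \<otimes>\<^bsub>D\<^esub> ?ida) = AMap R (m \<cdot>\<^bsub>C\<^esub> (x \<otimes>\<^bsub>C\<^esub> ?i)) \<cdot>\<^bsub>D\<^esub> LaxMult R b a"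
    if x: "x \<in> Hom C b a" for x b
  proof -
    have b: "b \<in> Obj C" using Hom_Obj[OF C.category_axioms x] by simp
    show ?thesis
      using LaxMult_natural[OF x i] Ri AMap_Comp[OF C.TArr_Hom[OF x i] m]
        D.Comp_assoc[OF D.TArr_Hom[OF AMap_Hom[OF x] I] P Rm]
        D.Comp_assoc[OF LaxMult_Hom[OF b a] AMap_Hom[OF C.TArr_Hom[OF x i]] Rm]
      by simp
  qed
  have right: "?m \<cdot>\<^bsub>D\<^esub> (?ida \<otimes>\<^bsub>D\<^esub> AMap R x) = AMap R (m \<cdot>\<^bsub>C\<^esub> (?i \<otimes>\<^bsub>C\<^esub> x)) \<cdot>\<^bsub>D\<^esub> LaxMult R a b"
    if x: "x \<in> Hom C b a" for x b
  proof -
    have b: "b \<in> Obj C" using Hom_Obj[OF C.category_axioms x] by simp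
    show ?thesis
      using LaxMult_natural[OF i x] Ri AMap_Comp[OF C.TArr_Hom[OF i x] m]
        D.Comp_assoc[OF D.TArr_Hom[OF I AMap_Hom[OF x]] P Rm]
        D.Comp_assoc[OF LaxMult_Hom[OF a b] AMap_Hom[OF C.TArr_Hom[OF i x]] Rm]
      by simp
  qed
  have spl: "(AMap R x \<cdot>\<^bsub>D\<^esub> q) \<otimes>\<^bsub>D\<^esub> ?ida = (AMap R x \<otimes>\<^bsub>D\<^esub> ?ida) \<cdot>\<^bsub>D\<^esub> (q \<otimes>\<^bsub>D\<^esub> ?ida)"
    and spr: "?ida \<otimes>\<^bsub>D\<^esub> (AMap R x \<cdot>\<^bsub>D\<^esub> q) = (?ida \<otimes>\<^bsub>D\<^esub> AMap R x) \<cdot>\<^bsub>D\<^esub> (?ida \<otimes>\<^bsub>D\<^esub> q)"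
    if "q \<in> Hom D c (OMap R b)" "x \<in> Hom C b a" for x q b c
    using D.TArr_Comp[OF that(1) AMap_Hom[OF that(2)] I I]
      D.TArr_Comp[OF I I that(1) AMap_Hom[OF that(2)]] D.Idn_left[OF I] by auto
  have L: "?m \<cdot>\<^bsub>D\<^esub> ((AMap R x \<cdot>\<^bsub>D\<^esub> q) \<otimes>\<^bsub>D\<^esub> ?ida)
      = AMap R (m \<cdot>\<^bsub>C\<^esub> (x \<otimes>\<^bsub>C\<^esub> ?i)) \<cdot>\<^bsub>D\<^esub> (LaxMult R b a \<cdot>\<^bsub>D\<^esub> (q \<otimes>\<^bsub>D\<^esub> ?ida))"
    if q: "q \<in> Hom D c (OMap R b)" and x: "x \<in> Hom C b a" for x q b c
  proof -
    have b: "b \<in> Obj C" using Hom_Obj[OF C.category_axioms x] by simp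
    show ?thesis
      using spl[OF q x] left[OF x]
        D.Comp_assoc[OF D.TArr_Hom[OF q I] D.TArr_Hom[OF AMap_Hom[OF x] I] hm]
        D.Comp_assoc[OF D.TArr_Hom[OF q I] LaxMult_Hom[OF b a]
          AMap_Hom[OF C.Comp_Hom[OF C.TArr_Hom[OF x i] m]]]
      by simp
  qed
  have R: "?m \<cdot>\<^bsub>D\<^esub> (?ida \<otimes>\<^bsub>D\<^esub> (AMap R x \<cdot>\<^bsub>D\<^esub> q))
      = AMap R (m \<cdot>\<^bsub>C\<^esub> (?i \<otimes>\<^bsub>C\<^esub> x)) \<cdot>\<^bsub>D\<^esub> (LaxMult R a b \<cdot>\<^bsub>D\<^esub> (?ida \<otimes>\<^bsub>D\<^esub> q))"
    if q: "q \<in> Hom D c (OMap R b)" and x: "x \<in> Hom C b a" for x q b c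
  proof -
    have b: "b \<in> Obj C" using Hom_Obj[OF C.category_axioms x] by simp
    show ?thesis
      using spr[OF q x] right[OF x]
        D.Comp_assoc[OF D.TArr_Hom[OF I q] D.TArr_Hom[OF I AMap_Hom[OF x]] hm]
        D.Comp_assoc[OF D.TArr_Hom[OF I q] LaxMult_Hom[OF a b]
          AMap_Hom[OF C.Comp_Hom[OF C.TArr_Hom[OF i x] m]]]
      by simp
  qed
  have lh: "LUnit C a \<in> Hom C (\<I>\<^bsub>C\<^esub> \<otimes>\<^sub>o\<^bsub>C\<^esub> a) a" and rh: "RUnit C a \<in> Hom C (a \<otimes>\<^sub>o\<^bsub>C\<^esub> \<I>\<^bsub>C\<^esub>) a"
    using C.LUnit_iso[OF a] C.RUnit_iso[OF a] by (auto simp: iso_in_def)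
  have 1: "?m \<cdot>\<^bsub>D\<^esub> (?e \<otimes>\<^bsub>D\<^esub> ?ida) = LUnit D ?A"
    using L[OF p e] lu lax_left_unit[OF a]
      D.Comp_assoc[OF D.TArr_Hom[OF p I] LaxMult_Hom[OF C.TUnit_Obj a] AMap_Hom[OF lh]] by simp
  have 2: "?m \<cdot>\<^bsub>D\<^esub> (?ida \<otimes>\<^bsub>D\<^esub> ?e) = RUnit D ?A"
    using R[OF p e] ru lax_right_unit[OF a]
      D.Comp_assoc[OF D.TArr_Hom[OF I p] LaxMult_Hom[OF a C.TUnit_Obj] AMap_Hom[OF rh]] by simp
  have "?m \<cdot>\<^bsub>D\<^esub> (?m \<otimes>\<^bsub>D\<^esub> ?ida)
      = AMap R (m \<cdot>\<^bsub>C\<^esub> (?i \<otimes>\<^bsub>C\<^esub> m) \<cdot>\<^bsub>C\<^esub> Assoc C a a a) \<cdot>\<^bsub>D\<^esub> (LaxMult R ?aa a \<cdot>\<^bsub>D\<^esub> (?P \<otimes>\<^bsub>D\<^esub> ?ida))"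
    using L[OF P m] ass by simp
  also have "\<dots> = AMap R (m \<cdot>\<^bsub>C\<^esub> (?i \<otimes>\<^bsub>C\<^esub> m))
      \<cdot>\<^bsub>D\<^esub> (AMap R (Assoc C a a a) \<cdot>\<^bsub>D\<^esub> LaxMult R ?aa a \<cdot>\<^bsub>D\<^esub> (?P \<otimes>\<^bsub>D\<^esub> ?ida))"
    using AMap_Comp[OF as C.Comp_Hom[OF im m]]
      D.Comp_assoc[OF D.Comp_Hom[OF P1 Pl] AMap_Hom[OF as] AMap_Hom[OF C.Comp_Hom[OF im m]]]
      D.Comp_assoc[OF P1 Pl AMap_Hom[OF as]] by simp
  also have "\<dots> = AMap R (m \<cdot>\<^bsub>C\<^esub> (?i \<otimes>\<^bsub>C\<^esub> m))
      \<cdot>\<^bsub>D\<^esub> (LaxMult R a ?aa \<cdot>\<^bsub>D\<^esub> (?ida \<otimes>\<^bsub>D\<^esub> ?P) \<cdot>\<^bsub>D\<^esub> Assoc D ?A ?A ?A)"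
    using lax_assoc[OF a a a] by simp
  also have "\<dots> = ?m \<cdot>\<^bsub>D\<^esub> (?ida \<otimes>\<^bsub>D\<^esub> ?m) \<cdot>\<^bsub>D\<^esub> Assoc D ?A ?A ?A"
    using R[OF P m]
      D.Comp_assoc[OF AS D.Comp_Hom[OF oneP Pr] AMap_Hom[OF C.Comp_Hom[OF im m]]] by simp
  finally have 3: "?m \<cdot>\<^bsub>D\<^esub> (?m \<otimes>\<^bsub>D\<^esub> ?ida) = \<dots>" .
  show ?thesis
    using A hm he 1 2 3
    by (simp add: monoid_in_def induced_mon_def flip: a_def m_def e_def)
qed

lemma is_functor_induced: "is_functor (Mon C) (Mon D) (induced_functor D R)"
proof -
  interpret MC: category "Mon C" by (rule C.category_Mon)
  interpret MD: category "Mon D" by (rule D.category_Mon)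
  show ?thesis
  proof
    fix M assume "M \<in> Obj (Mon C)"
    then show "OMap (induced_functor D R) M \<in> Obj (Mon D)"
      and "AMap (induced_functor D R) (Idn (Mon C) M)
        = Idn (Mon D) (OMap (induced_functor D R) M)"
      by (auto simp: induced_functor_def monoid_in_induced)
         (auto simp: induced_mon_def monoid_in_def AMap_Idn)
  next
    fix f M N assume "f \<in> Hom (Mon C) M N"
    then show "AMap (induced_functor D R) f
        \<in> Hom (Mon D) (OMap (induced_functor D R) M) (OMap (induced_functor D R) N)"
      by (auto simp: induced_functor_def Mon_Hom monoid_in_induced monoid_morphism_induced)
  next
    fix f g M N P assume "f \<in> Hom (Mon C) M N" "g \<in> Hom (Mon C) N P"
    then show "AMap (induced_functor D R) (g \<cdot>\<^bsub>Mon C\<^esub> f)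
        = AMap (induced_functor D R) g \<cdot>\<^bsub>Mon D\<^esub> AMap (induced_functor D R) f"
      by (auto simp: induced_functor_def Mon_Hom monoid_morphism_def AMap_Comp)
  qed
qed

end

end

theory Submission
  imports Defs
begin

text \<open>
  A left adjoint of \<open>R'\<close>, the functor induced by \<open>R\<close> on monoids, exists as soon as every monoid \<open>B\<close> of
  \<open>D\<close> has a universal arrow to \<open>R'\<close> (\<open>left_adjoint_if_universal_arrows\<close>). Let \<open>A = T L |B|\<close>. By the two
  given adjunctions, monoid morphisms \<open>A \<rightarrow> N\<close> correspond to arbitrary arrows \<open>|B| \<rightarrow> R |N|\<close> of \<open>D\<close>. To
  respect the multiplication and the unit of \<open>B\<close> is, for such an arrow, an equation between two
  arrows out of \<open>B \<otimes> B\<close> and one between two arrows out of the unit object. Transposed along the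
  adjunction of \<open>L\<close> and \<open>R\<close>, these equations say that the morphism \<open>A \<rightarrow> N\<close> equalizes a pair of
  arrows \<open>L (B \<otimes> B) \<rightarrow> |A|\<close> and a pair \<open>L I \<rightarrow> |A|\<close>, where \<open>I\<close> is the unit object of \<open>D\<close>. Hence the
  universal monoid quotient of \<open>A\<close> identifying the two arrows of each pair is the value at \<open>B\<close> of
  the wanted left adjoint (\<open>universal_arrow_induced\<close>).

  Such quotients are built as for rings, by dividing by a two-sided ideal (\<open>monoid_quotient_pair\<close>). For
  \<open>f, g : X \<rightarrow> |A|\<close>, take the coequalizer \<open>c : |A| \<rightarrow> Q\<close> in \<open>C\<close> of the bimodule maps
  \<open>A \<otimes> X \<otimes> A \<rightarrow> A\<close> that multiply \<open>f\<close>, respectively \<open>g\<close>, by a factor on each side. Since the tensor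
  product preserves this coequalizer, arrows out of \<open>Q \<otimes> Q\<close> are arrows out of \<open>A \<otimes> A\<close> compatible with
  the relation in each variable (\<open>coequalizer_square\<close>), and the multiplication of \<open>A\<close> followed by \<open>c\<close> is
  compatible because the relation is an ideal (\<open>two_sided_ideal\<close>). The monoid laws and the universal
  property pass to \<open>Q\<close> because \<open>c\<close> and its tensor products with itself and with identities are epi.
\<close>

section \<open>Universal arrows and adjunctions\<close>

definition universal_arrow where
  "universal_arrow C D F x a u \<longleftrightarrow> a \<in> Obj C \<and> u \<in> Hom D x (OMap F a) \<and>
    (\<forall>b \<in> Obj C. \<forall>f \<in> Hom D x (OMap F b). \<exists>!h. h \<in> Hom C a b \<and> AMap F h \<cdot>\<^bsub>D\<^esub> u = f)"

definition comp_func where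
  "comp_func G F = \<lparr>OMap = (\<lambda>a. OMap G (OMap F a)), AMap = (\<lambda>f. AMap G (AMap F f))\<rparr>"

text \<open>The mediating arrow of \<open>f\<close> is its transpose \<open>\<epsilon> \<cdot> L f\<close>; each triangle identity gives one half of
  the bijection.\<close>

lemma (in adjunction) universal_arrow_unit:
  assumes x: "x \<in> Obj D"
  shows "universal_arrow C D R x (OMap L x) (\<eta> x)"
  unfolding universal_arrow_def
proof (intro conjI ballI)
  show "OMap L x \<in> Obj C" "\<eta> x \<in> Hom D x (OMap R (OMap L x))"
    using x by (auto intro: L.OMap_Obj unit_Hom)
  fix b f assume b: "b \<in> Obj C" and f: "f \<in> Hom D x (OMap R b)"
  note Lf = L.AMap_Hom[OF f] and e = counit_Hom[OF b] and n = unit_Hom[OF x]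
  show "\<exists>!h. h \<in> Hom C (OMap L x) b \<and> AMap R h \<cdot>\<^bsub>D\<^esub> \<eta> x = f"
  proof (intro ex1I conjI)
    show "\<epsilon> b \<cdot>\<^bsub>C\<^esub> AMap L f \<in> Hom C (OMap L x) b"
      using L.D.Comp_Hom[OF Lf e] .
    have Rb: "OMap R b \<in> Obj D" by (rule R.OMap_Obj[OF b])
    show "AMap R (\<epsilon> b \<cdot>\<^bsub>C\<^esub> AMap L f) \<cdot>\<^bsub>D\<^esub> \<eta> x = f"
      using R.AMap_Comp[OF Lf e] L.C.Comp_assoc[OF n R.AMap_Hom[OF Lf] R.AMap_Hom[OF e]]
        unit_natural[OF f] L.C.Comp_assoc[OF f unit_Hom[OF Rb] R.AMap_Hom[OF e]]
        triangle_right[OF b] L.C.Idn_left[OF f] by simp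
  next
    fix h assume "h \<in> Hom C (OMap L x) b \<and> AMap R h \<cdot>\<^bsub>D\<^esub> \<eta> x = f"
    then have h: "h \<in> Hom C (OMap L x) b" and hf: "AMap R h \<cdot>\<^bsub>D\<^esub> \<eta> x = f" by auto
    have "\<epsilon> b \<cdot>\<^bsub>C\<^esub> AMap L f
        = (\<epsilon> b \<cdot>\<^bsub>C\<^esub> AMap L (AMap R h)) \<cdot>\<^bsub>C\<^esub> AMap L (\<eta> x)"
      using L.AMap_Comp[OF n R.AMap_Hom[OF h]] hf
        L.D.Comp_assoc[OF L.AMap_Hom[OF n] L.AMap_Hom[OF R.AMap_Hom[OF h]] e] by simp
    also have "\<dots> = h"
      using counit_natural[OF h]
        L.D.Comp_assoc[OF L.AMap_Hom[OF n] counit_Hom[OF L.OMap_Obj[OF x]] h]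
        triangle_left[OF x] L.D.Idn_right[OF h] by simp
    finally show "h = \<epsilon> b \<cdot>\<^bsub>C\<^esub> AMap L f" by simp
  qed
qed

lemma universal_arrow_comp:
  assumes F: "is_functor C D F" and G: "is_functor D E G"
    and u: "universal_arrow D E G x d u" and v: "universal_arrow C D F d a v"
  shows "universal_arrow C E (comp_func G F) x a (AMap G v \<cdot>\<^bsub>E\<^esub> u)"
proof -
  interpret F: is_functor C D F by (rule F)
  interpret G: is_functor D E G by (rule G)
  have d: "d \<in> Obj D" and u1: "u \<in> Hom E x (OMap G d)"
    and u2: "\<And>b f. b \<in> Obj D \<Longrightarrow> f \<in> Hom E x (OMap G b)
      \<Longrightarrow> \<exists>!h. h \<in> Hom D d b \<and> AMap G h \<cdot>\<^bsub>E\<^esub> u = f"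
    using u by (auto simp: universal_arrow_def)
  have a: "a \<in> Obj C" and v1: "v \<in> Hom D d (OMap F a)"
    and v2: "\<And>b f. b \<in> Obj C \<Longrightarrow> f \<in> Hom D d (OMap F b)
      \<Longrightarrow> \<exists>!h. h \<in> Hom C a b \<and> AMap F h \<cdot>\<^bsub>D\<^esub> v = f"
    using v by (auto simp: universal_arrow_def)
  have split: "AMap G (AMap F h) \<cdot>\<^bsub>E\<^esub> (AMap G v \<cdot>\<^bsub>E\<^esub> u) = AMap G (AMap F h \<cdot>\<^bsub>D\<^esub> v) \<cdot>\<^bsub>E\<^esub> u"
    if "h \<in> Hom C a b" for h b
    using G.D.Comp_assoc[OF u1 G.AMap_Hom[OF v1] G.AMap_Hom[OF F.AMap_Hom[OF that]]]
      G.AMap_Comp[OF v1 F.AMap_Hom[OF that]] by simp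
  have "\<exists>!h. h \<in> Hom C a b \<and> AMap G (AMap F h) \<cdot>\<^bsub>E\<^esub> (AMap G v \<cdot>\<^bsub>E\<^esub> u) = f"
    if b: "b \<in> Obj C" and f: "f \<in> Hom E x (OMap G (OMap F b))" for b f
  proof -
    obtain k where k: "k \<in> Hom D d (OMap F b)" "AMap G k \<cdot>\<^bsub>E\<^esub> u = f"
      and k_uniq: "\<And>k'. k' \<in> Hom D d (OMap F b) \<Longrightarrow> AMap G k' \<cdot>\<^bsub>E\<^esub> u = f \<Longrightarrow> k' = k"
      using u2[OF F.OMap_Obj[OF b] f] by blast
    obtain h where h: "h \<in> Hom C a b" "AMap F h \<cdot>\<^bsub>D\<^esub> v = k"
      and h_uniq: "\<And>h'. h' \<in> Hom C a b \<Longrightarrow> AMap F h' \<cdot>\<^bsub>D\<^esub> v = k \<Longrightarrow> h' = h"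
      using v2[OF b k(1)] by blast
    show ?thesis
    proof (intro ex1I conjI)
      show "h \<in> Hom C a b" by (rule h)
      show "AMap G (AMap F h) \<cdot>\<^bsub>E\<^esub> (AMap G v \<cdot>\<^bsub>E\<^esub> u) = f"
        using split[OF h(1)] h(2) k(2) by simp
    next
      fix h' assume h': "h' \<in> Hom C a b \<and> AMap G (AMap F h') \<cdot>\<^bsub>E\<^esub> (AMap G v \<cdot>\<^bsub>E\<^esub> u) = f"
      then have "AMap G (AMap F h' \<cdot>\<^bsub>D\<^esub> v) \<cdot>\<^bsub>E\<^esub> u = f" using split by metis
      then have "AMap F h' \<cdot>\<^bsub>D\<^esub> v = k"
        using k_uniq F.D.Comp_Hom[OF v1 F.AMap_Hom] h' by blast
      then show "h' = h" using h_uniq h' by blast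
    qed
  qed
  then show ?thesis
    using a G.D.Comp_Hom[OF u1 G.AMap_Hom[OF v1]]
    by (simp add: universal_arrow_def comp_func_def)
qed

text \<open>A condition in \<open>D\<close> of the form \<open>F h \<cdot> s = F h \<cdot> t\<close> is a condition on \<open>h\<close> alone: \<open>F h \<cdot> s\<close> transposes
  to \<open>h \<cdot> s'\<close>, and transposition is injective. This is how the laws of a monoid morphism, which live in
  \<open>D\<close>, become pairs of arrows to be identified in \<open>C\<close>.\<close>

lemma universal_arrow_transpose_pair:
  assumes F: "is_functor C D F" and u: "universal_arrow C D F y l u"
    and s: "s \<in> Hom D y (OMap F a)" and t: "t \<in> Hom D y (OMap F a)" and a: "a \<in> Obj C"
  shows "\<exists>s' \<in> Hom C l a. \<exists>t' \<in> Hom C l a. \<forall>b. \<forall>h \<in> Hom C a b.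
    AMap F h \<cdot>\<^bsub>D\<^esub> s = AMap F h \<cdot>\<^bsub>D\<^esub> t \<longleftrightarrow> h \<cdot>\<^bsub>C\<^esub> s' = h \<cdot>\<^bsub>C\<^esub> t'"
proof -
  interpret F: is_functor C D F by (rule F)
  have u1: "u \<in> Hom D y (OMap F l)"
    and u2: "\<And>b f. b \<in> Obj C \<Longrightarrow> f \<in> Hom D y (OMap F b)
      \<Longrightarrow> \<exists>!h. h \<in> Hom C l b \<and> AMap F h \<cdot>\<^bsub>D\<^esub> u = f"
    using u by (auto simp: universal_arrow_def)
  obtain s' where s': "s' \<in> Hom C l a" "AMap F s' \<cdot>\<^bsub>D\<^esub> u = s" using u2[OF a s] by blast
  obtain t' where t': "t' \<in> Hom C l a" "AMap F t' \<cdot>\<^bsub>D\<^esub> u = t" using u2[OF a t] by blast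
  have "AMap F h \<cdot>\<^bsub>D\<^esub> s = AMap F h \<cdot>\<^bsub>D\<^esub> t \<longleftrightarrow> h \<cdot>\<^bsub>C\<^esub> s' = h \<cdot>\<^bsub>C\<^esub> t'"
    if h: "h \<in> Hom C a b" for h b
  proof -
    have b: "b \<in> Obj C" using Hom_Obj[OF F.C.category_axioms h] by simp
    have tr: "AMap F (h \<cdot>\<^bsub>C\<^esub> r) \<cdot>\<^bsub>D\<^esub> u = AMap F h \<cdot>\<^bsub>D\<^esub> (AMap F r \<cdot>\<^bsub>D\<^esub> u)"
      if r: "r \<in> Hom C l a" for r
      using F.AMap_Comp[OF r h] F.D.Comp_assoc[OF u1 F.AMap_Hom[OF r] F.AMap_Hom[OF h]] by simp
    note hs = F.C.Comp_Hom[OF s'(1) h] and ht = F.C.Comp_Hom[OF t'(1) h]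
    show ?thesis
      using u2[OF b F.D.Comp_Hom[OF u1 F.AMap_Hom[OF hs]]] tr[OF s'(1)] tr[OF t'(1)] hs ht s'(2) t'(2)
      by metis
  qed
  then show ?thesis using s'(1) t'(1) by blast
qed

text \<open>Once an arrow out of \<open>l x\<close> is determined by its transpose (\<open>eqI\<close> in the proof), functoriality,
  naturality of the counit and the left triangle all follow by comparing transposes.\<close>

lemma left_adjoint_if_universal_arrows:
  fixes C :: "('o1, 'a1, 'm1) category_scheme" and D :: "('o2, 'a2, 'm2) category_scheme"
    and F :: "('o1, 'a1, 'o2, 'a2, 'f) func_scheme"
  assumes F: "is_functor C D F"
    and univ: "\<And>x. x \<in> Obj D \<Longrightarrow> \<exists>a u. universal_arrow C D F x a u"
  shows "\<exists>L :: ('o2, 'a2, 'o1, 'a1) func. is_left_adjoint C D L F"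
proof -
  interpret F: is_functor C D F by (rule F)
  obtain l u where lu: "\<And>x. x \<in> Obj D \<Longrightarrow> universal_arrow C D F x (l x) (u x)"
    using univ by metis
  have l: "l x \<in> Obj C" and u: "u x \<in> Hom D x (OMap F (l x))" if "x \<in> Obj D" for x
    using lu[OF that] by (auto simp: universal_arrow_def)
  \<comment> \<open>The transpose of an arrow into a value of \<open>F\<close>.\<close>
  define tr where "tr x b f = (THE h. h \<in> Hom C (l x) b \<and> AMap F h \<cdot>\<^bsub>D\<^esub> u x = f)" for x b f
  have ex1: "\<exists>!h. h \<in> Hom C (l x) b \<and> AMap F h \<cdot>\<^bsub>D\<^esub> u x = f"
    if "x \<in> Obj D" "b \<in> Obj C" "f \<in> Hom D x (OMap F b)" for x b f
    using lu[OF that(1)] that(2,3) by (auto simp: universal_arrow_def)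
  have tr: "tr x b f \<in> Hom C (l x) b" "AMap F (tr x b f) \<cdot>\<^bsub>D\<^esub> u x = f"
    if "x \<in> Obj D" "b \<in> Obj C" "f \<in> Hom D x (OMap F b)" for x b f
    using theI'[OF ex1[OF that]] by (simp_all add: tr_def)
  have eqI: "h = k"
    if "x \<in> Obj D" "h \<in> Hom C (l x) b" "k \<in> Hom C (l x) b"
      "AMap F h \<cdot>\<^bsub>D\<^esub> u x = AMap F k \<cdot>\<^bsub>D\<^esub> u x" for x b h k
  proof -
    have b: "b \<in> Obj C" using Hom_Obj[OF F.C.category_axioms that(2)] by simp
    show ?thesis
      using ex1[OF that(1) b F.D.Comp_Hom[OF u[OF that(1)] F.AMap_Hom[OF that(2)]]] that by metis
  qed
  define L :: "('o2, 'a2, 'o1, 'a1) func" where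
    "L = \<lparr>OMap = l, AMap = (\<lambda>f. tr (Dom D f) (l (Cod D f)) (u (Cod D f) \<cdot>\<^bsub>D\<^esub> f))\<rparr>"
  have LO [simp]: "OMap L x = l x" for x by (simp add: L_def)
  have LA: "AMap L f \<in> Hom C (l x) (l y)" "AMap F (AMap L f) \<cdot>\<^bsub>D\<^esub> u x = u y \<cdot>\<^bsub>D\<^esub> f"
    if f: "f \<in> Hom D x y" for f x y
  proof -
    have xy: "x \<in> Obj D" "y \<in> Obj D" using Hom_Obj[OF F.D.category_axioms f] .
    have "AMap L f = tr x (l y) (u y \<cdot>\<^bsub>D\<^esub> f)" using f by (simp add: L_def Hom_def)
    then show "AMap L f \<in> Hom C (l x) (l y)" "AMap F (AMap L f) \<cdot>\<^bsub>D\<^esub> u x = u y \<cdot>\<^bsub>D\<^esub> f"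
      using tr[OF xy(1) l[OF xy(2)] F.D.Comp_Hom[OF f u[OF xy(2)]]] by simp_all
  qed
  have L: "is_functor D C L"
  proof
    fix a assume "a \<in> Obj D" then show "OMap L a \<in> Obj C" by (simp add: l)
  next
    fix f a b assume "f \<in> Hom D a b"
    then show "AMap L f \<in> Hom C (OMap L a) (OMap L b)" by (simp add: LA)
  next
    fix a assume a: "a \<in> Obj D"
    note i = F.D.Idn_Hom[OF a]
    show "AMap L (Idn D a) = Idn C (OMap L a)"
      using eqI[OF a LA(1)[OF i] F.C.Idn_Hom[OF l[OF a]]] LA(2)[OF i] F.AMap_Idn[OF l[OF a]]
        F.D.Idn_left[OF u[OF a]] F.D.Idn_right[OF u[OF a]] by simp
  next
    fix f a b g c assume f: "f \<in> Hom D a b" and g: "g \<in> Hom D b c"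
    have o: "a \<in> Obj D" "b \<in> Obj D" "c \<in> Obj D"
      using Hom_Obj[OF F.D.category_axioms f] Hom_Obj[OF F.D.category_axioms g] by auto
    note gf = F.D.Comp_Hom[OF f g]
    note Ff = F.AMap_Hom[OF LA(1)[OF f]] and Fg = F.AMap_Hom[OF LA(1)[OF g]]
    have "AMap F (AMap L g \<cdot>\<^bsub>C\<^esub> AMap L f) \<cdot>\<^bsub>D\<^esub> u a = u c \<cdot>\<^bsub>D\<^esub> (g \<cdot>\<^bsub>D\<^esub> f)"
      using F.AMap_Comp[OF LA(1)[OF f] LA(1)[OF g]] F.D.Comp_assoc[OF u[OF o(1)] Ff Fg]
        LA(2)[OF f] LA(2)[OF g] F.D.Comp_assoc[OF f u[OF o(2)] Fg]
        F.D.Comp_assoc[OF f g u[OF o(3)]] by simp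
    then show "AMap L (g \<cdot>\<^bsub>D\<^esub> f) = AMap L g \<cdot>\<^bsub>C\<^esub> AMap L f"
      using eqI[OF o(1) LA(1)[OF gf] F.C.Comp_Hom[OF LA(1)[OF f] LA(1)[OF g]]] LA(2)[OF gf]
      by simp
  qed
  interpret L: is_functor D C L by (rule L)
  define e where "e a = tr (OMap F a) a (Idn D (OMap F a))" for a
  have e: "e a \<in> Hom C (l (OMap F a)) a" "AMap F (e a) \<cdot>\<^bsub>D\<^esub> u (OMap F a) = Idn D (OMap F a)"
    if "a \<in> Obj C" for a
    using tr[OF F.OMap_Obj[OF that] that F.D.Idn_Hom[OF F.OMap_Obj[OF that]]]
    by (simp_all add: e_def)
  have "adjunction C D L F u e"
  proof
    fix x assume "x \<in> Obj D"
    then show "u x \<in> Hom D x (OMap F (OMap L x))" by (simp add: u)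
  next
    fix f x y assume "f \<in> Hom D x y"
    then show "u y \<cdot>\<^bsub>D\<^esub> f = AMap F (AMap L f) \<cdot>\<^bsub>D\<^esub> u x" by (simp add: LA)
  next
    fix a assume "a \<in> Obj C"
    then show "e a \<in> Hom C (OMap L (OMap F a)) a" by (simp add: e)
  next
    fix g a b assume g: "g \<in> Hom C a b"
    have o: "a \<in> Obj C" "b \<in> Obj C" using Hom_Obj[OF F.C.category_axioms g] by auto
    note Fo = F.OMap_Obj[OF o(1)] F.OMap_Obj[OF o(2)]
    note Fg = F.AMap_Hom[OF g]
    note LFg = LA[OF Fg]
    note h1 = F.C.Comp_Hom[OF LFg(1) e(1)[OF o(2)]] and h2 = F.C.Comp_Hom[OF e(1)[OF o(1)] g]
    have 1: "AMap F (e b \<cdot>\<^bsub>C\<^esub> AMap L (AMap F g)) \<cdot>\<^bsub>D\<^esub> u (OMap F a) = AMap F g"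
      using F.AMap_Comp[OF LFg(1) e(1)[OF o(2)]]
        F.D.Comp_assoc[OF u[OF Fo(1)] F.AMap_Hom[OF LFg(1)] F.AMap_Hom[OF e(1)[OF o(2)]]]
        F.D.Comp_assoc[OF Fg u[OF Fo(2)] F.AMap_Hom[OF e(1)[OF o(2)]]] LFg(2) e(2)[OF o(2)]
        F.D.Idn_left[OF Fg] by simp
    have 2: "AMap F (g \<cdot>\<^bsub>C\<^esub> e a) \<cdot>\<^bsub>D\<^esub> u (OMap F a) = AMap F g"
      using F.AMap_Comp[OF e(1)[OF o(1)] g] e(2)[OF o(1)] F.D.Idn_right[OF Fg]
        F.D.Comp_assoc[OF u[OF Fo(1)] F.AMap_Hom[OF e(1)[OF o(1)]] Fg] by simp
    show "e b \<cdot>\<^bsub>C\<^esub> AMap L (AMap F g) = g \<cdot>\<^bsub>C\<^esub> e a"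
      using eqI[OF Fo(1) h1 h2] 1 2 by simp
  next
    fix x assume x: "x \<in> Obj D"
    note lx = l[OF x]
    note ux = u[OF x]
    note Lu = LA[OF ux]
    have "AMap F (e (l x) \<cdot>\<^bsub>C\<^esub> AMap L (u x)) \<cdot>\<^bsub>D\<^esub> u x = u x"
      using F.AMap_Comp[OF Lu(1) e(1)[OF lx]]
        F.D.Comp_assoc[OF ux F.AMap_Hom[OF Lu(1)] F.AMap_Hom[OF e(1)[OF lx]]]
        F.D.Comp_assoc[OF ux u[OF F.OMap_Obj[OF lx]] F.AMap_Hom[OF e(1)[OF lx]]]
        Lu(2) e(2)[OF lx] F.D.Idn_left[OF ux] by simp
    then show "e (OMap L x) \<cdot>\<^bsub>C\<^esub> AMap L (u x) = Idn C (OMap L x)"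
      using eqI[OF x F.C.Comp_Hom[OF Lu(1) e(1)[OF lx]] F.C.Idn_Hom[OF lx]] F.AMap_Idn[OF lx]
        F.D.Idn_left[OF ux] by simp
  next
    fix a assume "a \<in> Obj C"
    then show "AMap F (e a) \<cdot>\<^bsub>D\<^esub> u (OMap F a) = Idn D (OMap F a)" by (simp add: e)
  qed
  then show ?thesis unfolding is_left_adjoint_def by blast
qed

section \<open>Calculus of arrows, epimorphisms and coequalizers\<close>

context category
begin

text \<open>Typing by \<open>Arr\<close>, \<open>Dom\<close> and \<open>Cod\<close> leaves no intermediate object to be guessed, so that the
  simplifier can discharge the side conditions of associativity and interchange by rewriting;
  membership in \<open>Hom\<close> cannot be used in this way.\<close>

lemma Idn_Arr [simp]: "a \<in> Obj C \<Longrightarrow> Idn C a \<in> Arr C" "a \<in> Obj C \<Longrightarrow> Dom C (Idn C a) = a"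
    "a \<in> Obj C \<Longrightarrow> Cod C (Idn C a) = a"
  using Idn_Hom by (auto simp: Hom_def)

lemma Comp_Arr [simp]:
  assumes "f \<in> Arr C" "g \<in> Arr C" "Cod C f = Dom C g"
  shows "g \<cdot> f \<in> Arr C" "Dom C (g \<cdot> f) = Dom C f" "Cod C (g \<cdot> f) = Cod C g"
  using Comp_Hom[of f "Dom C f" "Cod C f" g "Cod C g"] assms by (auto simp: Hom_def)

lemma Comp_Idn_Arr [simp]:
  "f \<in> Arr C \<Longrightarrow> a = Dom C f \<Longrightarrow> f \<cdot> Idn C a = f"
  "f \<in> Arr C \<Longrightarrow> a = Cod C f \<Longrightarrow> Idn C a \<cdot> f = f"
  by (auto intro: Idn_left Idn_right simp: Hom_def)

lemma Comp_assoc_Arr: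
  "f \<in> Arr C \<Longrightarrow> g \<in> Arr C \<Longrightarrow> h \<in> Arr C \<Longrightarrow> Cod C f = Dom C g \<Longrightarrow> Cod C g = Dom C h
    \<Longrightarrow> (h \<cdot> g) \<cdot> f = h \<cdot> (g \<cdot> f)"
  by (rule Comp_assoc) (auto simp: Hom_def)

declare Dom_Obj [simp] Cod_Obj [simp]

end

text \<open>Equal composites with \<open>f\<close> have equal codomains, so only the domains of \<open>g\<close> and \<open>h\<close> are
  constrained.\<close>

definition epi where
  "epi C f \<longleftrightarrow> f \<in> Arr C \<and> (\<forall>g \<in> Arr C. \<forall>h \<in> Arr C. Dom C g = Cod C f \<longrightarrow> Dom C h = Cod C f
    \<longrightarrow> g \<cdot>\<^bsub>C\<^esub> f = h \<cdot>\<^bsub>C\<^esub> f \<longrightarrow> g = h)"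

lemma epi_cancel:
  "epi C f \<Longrightarrow> g \<cdot>\<^bsub>C\<^esub> f = h \<cdot>\<^bsub>C\<^esub> f \<Longrightarrow> g \<in> Arr C \<Longrightarrow> h \<in> Arr C \<Longrightarrow> Dom C g = Cod C f
    \<Longrightarrow> Dom C h = Cod C f \<Longrightarrow> g = h"
  by (simp add: epi_def)

lemma epi_Arr: "epi C f \<Longrightarrow> f \<in> Arr C"
  by (simp add: epi_def)

context category
begin

lemma epi_Comp:
  assumes "epi C f" "epi C g" "Cod C f = Dom C g"
  shows "epi C (g \<cdot> f)"
  unfolding epi_def
proof (intro conjI ballI impI)
  note a [simp] = assms(1,2)[THEN epi_Arr] assms(3)
  show "g \<cdot> f \<in> Arr C" by simp
  fix h k assume h [simp]: "h \<in> Arr C" "k \<in> Arr C" and "Dom C h = Cod C (g \<cdot> f)"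
    and "Dom C k = Cod C (g \<cdot> f)" and eq: "h \<cdot> (g \<cdot> f) = k \<cdot> (g \<cdot> f)"
  then have [simp]: "Dom C h = Cod C g" "Dom C k = Cod C g" by simp_all
  have "(h \<cdot> g) \<cdot> f = (k \<cdot> g) \<cdot> f" using eq by (simp add: Comp_assoc_Arr)
  then have "h \<cdot> g = k \<cdot> g" by (rule epi_cancel[OF assms(1)]) simp_all
  then show "h = k" by (rule epi_cancel[OF assms(2)]) simp_all
qed

lemma epi_iso:
  assumes "iso_in C a b f"
  shows "epi C f"
proof -
  obtain g where f: "f \<in> Hom C a b" and g: "g \<in> Hom C b a" and fg: "f \<cdot> g = Idn C b"
    using assms by (auto simp: iso_in_def)
  have "h = (h \<cdot> f) \<cdot> g" if "h \<in> Arr C" "Dom C h = Cod C f" for h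
    using f g fg that Comp_assoc_Arr[of g f h] by (simp add: Hom_def)
  then show ?thesis
    using f unfolding epi_def by (metis (no_types, lifting) Hom_def mem_Collect_eq)
qed

lemma coequalizer_Arr:
  assumes "is_coequalizer C f g q"
  shows "f \<in> Arr C" "g \<in> Arr C" "q \<in> Arr C" "Dom C g = Dom C f" "Cod C g = Cod C f"
    "Dom C q = Cod C f" "q \<cdot> f = q \<cdot> g"
  using assms by (auto simp: is_coequalizer_def Hom_def)

lemma coequalizer_ex1:
  assumes "is_coequalizer C f g q" "h \<in> Arr C" "Dom C h = Cod C f" "h \<cdot> f = h \<cdot> g"
  shows "\<exists>!k. k \<in> Hom C (Cod C q) (Cod C h) \<and> k \<cdot> q = h"
proof -
  have "h \<in> Hom C (Cod C f) (Cod C h)" using assms by (simp add: Hom_def)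
  moreover have "\<forall>d. \<forall>h \<in> Hom C (Cod C f) d. h \<cdot> f = h \<cdot> g
      \<longrightarrow> (\<exists>!k. k \<in> Hom C (Cod C q) d \<and> k \<cdot> q = h)"
    using assms(1) unfolding is_coequalizer_def by (elim exE conjE) (simp add: Hom_def)
  ultimately show ?thesis using assms(4) by metis
qed

lemma coequalizer_factor:
  assumes "is_coequalizer C f g q" "h \<in> Arr C" "Dom C h = Cod C f" "h \<cdot> f = h \<cdot> g"
  shows "\<exists>k \<in> Arr C. Dom C k = Cod C q \<and> Cod C k = Cod C h \<and> k \<cdot> q = h"
  using ex1_implies_ex[OF coequalizer_ex1[OF assms]] by (auto simp: Hom_def)

lemma coequalizer_epi:
  assumes c: "is_coequalizer C f g q"
  shows "epi C q"
  unfolding epi_def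
proof (intro conjI ballI impI)
  note q [simp] = coequalizer_Arr(1-6)[OF c]
  show "q \<in> Arr C" by simp
  fix h k assume hk [simp]: "h \<in> Arr C" "k \<in> Arr C" "Dom C h = Cod C q" "Dom C k = Cod C q"
    and eq: "h \<cdot> q = k \<cdot> q"
  have cod: "Cod C h = Cod C k"
    using arg_cong[OF eq, of "Cod C"] by simp
  have "(h \<cdot> q) \<cdot> f = (h \<cdot> q) \<cdot> g"
    using coequalizer_Arr(7)[OF c] by (simp add: Comp_assoc_Arr)
  from coequalizer_ex1[OF c _ _ this]
  have "\<exists>!l. l \<in> Hom C (Cod C q) (Cod C k) \<and> l \<cdot> q = h \<cdot> q" by (simp add: cod)
  moreover have "h \<in> Hom C (Cod C q) (Cod C k) \<and> h \<cdot> q = h \<cdot> q"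
    "k \<in> Hom C (Cod C q) (Cod C k) \<and> k \<cdot> q = h \<cdot> q"
    using cod eq by (simp_all add: Hom_def)
  ultimately show "h = k" by (elim ex1E) metis
qed

end

section \<open>Coequalizers preserved by the tensor product\<close>

context monoidal_category
begin

lemma TArr_Arr [simp]:
  assumes "f \<in> Arr C" "g \<in> Arr C"
  shows "f \<otimes> g \<in> Arr C" "Dom C (f \<otimes> g) = Dom C f \<otimes>\<^sub>o Dom C g"
    "Cod C (f \<otimes> g) = Cod C f \<otimes>\<^sub>o Cod C g"
  using TArr_Hom[of f "Dom C f" "Cod C f" g "Dom C g" "Cod C g"] assms by (auto simp: Hom_def)

lemma interchange:
  "f \<in> Arr C \<Longrightarrow> g \<in> Arr C \<Longrightarrow> f' \<in> Arr C \<Longrightarrow> g' \<in> Arr C \<Longrightarrow> Cod C f = Dom C g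
    \<Longrightarrow> Cod C f' = Dom C g' \<Longrightarrow> (g \<otimes> g') \<cdot> (f \<otimes> f') = (g \<cdot> f) \<otimes> (g' \<cdot> f')"
  using TArr_Comp[of f "Dom C f" "Cod C f" g "Cod C g" f' "Dom C f'" "Cod C f'" g' "Cod C g'"]
  by (simp add: Hom_def)

declare TObj_Obj [simp] TUnit_Obj [simp] TArr_Idn [simp]

lemma Assoc_Arr [simp]:
  assumes "a \<in> Obj C" "b \<in> Obj C" "c \<in> Obj C"
  shows "Assoc C a b c \<in> Arr C" "Dom C (Assoc C a b c) = (a \<otimes>\<^sub>o b) \<otimes>\<^sub>o c"
    "Cod C (Assoc C a b c) = a \<otimes>\<^sub>o (b \<otimes>\<^sub>o c)"
  using Assoc_iso[OF assms] by (auto simp: iso_in_def Hom_def)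

lemma LUnit_Arr [simp]:
  assumes "a \<in> Obj C"
  shows "LUnit C a \<in> Arr C" "Dom C (LUnit C a) = \<I> \<otimes>\<^sub>o a" "Cod C (LUnit C a) = a"
  using LUnit_iso[OF assms] by (auto simp: iso_in_def Hom_def)

lemma RUnit_Arr [simp]:
  assumes "a \<in> Obj C"
  shows "RUnit C a \<in> Arr C" "Dom C (RUnit C a) = a \<otimes>\<^sub>o \<I>" "Cod C (RUnit C a) = a"
  using RUnit_iso[OF assms] by (auto simp: iso_in_def Hom_def)

lemma Assoc_natural_Arr:
  "f \<in> Arr C \<Longrightarrow> g \<in> Arr C \<Longrightarrow> h \<in> Arr C \<Longrightarrow>
    Assoc C (Cod C f) (Cod C g) (Cod C h) \<cdot> ((f \<otimes> g) \<otimes> h)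
      = (f \<otimes> (g \<otimes> h)) \<cdot> Assoc C (Dom C f) (Dom C g) (Dom C h)"
  by (rule Assoc_natural) (auto simp: Hom_def)

lemma coequalizer_tensor:
  assumes "tensor_preserves_coequalizers C" "is_coequalizer C f g q" "a \<in> Obj C"
  shows "is_coequalizer C (Idn C a \<otimes> f) (Idn C a \<otimes> g) (Idn C a \<otimes> q)"
    "is_coequalizer C (f \<otimes> Idn C a) (g \<otimes> Idn C a) (q \<otimes> Idn C a)"
  using assms
  by (auto simp: tensor_preserves_coequalizers_def preserves_coequalizers_def tensor_left_def
      tensor_right_def)

end

section \<open>Monoids and generalized elements\<close>

text \<open>The product of two generalized elements of \<open>M\<close>. In this notation the monoid laws read like those of an
  ordinary monoid, up to the structural isomorphisms, and the multiplication is the convolution of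
  two identities.\<close>

definition convolution where
  "convolution C M x y = MMult M \<cdot>\<^bsub>C\<^esub> (x \<otimes>\<^bsub>C\<^esub> y)"

locale monoid_object = monoidal_category C for C :: "('o, 'a, 'm) monoidal_scheme" (structure) +
  fixes M :: "('o, 'a) mon"
  assumes monoid: "monoid_in C M"
begin

abbreviation mprod (infixl "\<star>" 72) where "x \<star> y \<equiv> convolution C M x y"

lemma MArr [simp]: "MObj M \<in> Obj C" "MMult M \<in> Arr C" "Dom C (MMult M) = MObj M \<otimes>\<^sub>o MObj M"
   "Cod C (MMult M) = MObj M" "MUnit M \<in> Arr C" "Dom C (MUnit M) = \<I>" "Cod C (MUnit M) = MObj M"
  using monoid by (auto simp: monoid_in_def Hom_def)

lemma convolution_Arr [simp]:
  assumes "x \<in> Arr C" "y \<in> Arr C" "Cod C x = MObj M" "Cod C y = MObj M"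
  shows "x \<star> y \<in> Arr C" "Dom C (x \<star> y) = Dom C x \<otimes>\<^sub>o Dom C y" "Cod C (x \<star> y) = MObj M"
  using assms by (simp_all add: convolution_def)

lemma convolution_Comp:
  assumes "x \<in> Arr C" "y \<in> Arr C" "Cod C x = MObj M" "Cod C y = MObj M"
    "f \<in> Arr C" "g \<in> Arr C" "Cod C f = Dom C x" "Cod C g = Dom C y"
  shows "(x \<cdot> f) \<star> (y \<cdot> g) = (x \<star> y) \<cdot> (f \<otimes> g)"
  using assms by (simp add: convolution_def Comp_assoc_Arr interchange)

text \<open>Associativity for arbitrary generalized elements is the monoid law for identities combined with
  naturality of the associator.\<close>

lemma convolution_assoc:
  assumes [simp]: "x \<in> Arr C" "y \<in> Arr C" "z \<in> Arr C"
    "Cod C x = MObj M" "Cod C y = MObj M" "Cod C z = MObj M"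
  shows "(x \<star> y) \<star> z = (x \<star> (y \<star> z)) \<cdot> Assoc C (Dom C x) (Dom C y) (Dom C z)"
proof -
  have "(x \<star> y) \<star> z = MMult M \<cdot> (MMult M \<otimes> Idn C (MObj M)) \<cdot> ((x \<otimes> y) \<otimes> z)"
    by (simp add: convolution_def Comp_assoc_Arr interchange)
  also have "\<dots> = MMult M \<cdot> (Idn C (MObj M) \<otimes> MMult M)
          \<cdot> Assoc C (MObj M) (MObj M) (MObj M) \<cdot> ((x \<otimes> y) \<otimes> z)"
    using monoid by (simp add: monoid_in_def)
  also have "\<dots> = MMult M \<cdot> (Idn C (MObj M) \<otimes> MMult M)
          \<cdot> ((x \<otimes> (y \<otimes> z)) \<cdot> Assoc C (Dom C x) (Dom C y) (Dom C z))"
    using Assoc_natural_Arr[of x y z] by (simp add: Comp_assoc_Arr)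
  also have "\<dots> = MMult M \<cdot> ((Idn C (MObj M) \<otimes> MMult M)
          \<cdot> (x \<otimes> (y \<otimes> z))) \<cdot> Assoc C (Dom C x) (Dom C y) (Dom C z)"
    by (simp add: Comp_assoc_Arr)
  also have "\<dots> = (x \<star> (y \<star> z)) \<cdot> Assoc C (Dom C x) (Dom C y) (Dom C z)"
    by (simp add: convolution_def interchange)
  finally show ?thesis .
qed

lemma convolution_unit:
  assumes [simp]: "x \<in> Arr C" "Cod C x = MObj M"
  shows "MUnit M \<star> x = x \<cdot> LUnit C (Dom C x)" "x \<star> MUnit M = x \<cdot> RUnit C (Dom C x)"
proof -
  have "MUnit M \<star> x = (MMult M \<cdot> (MUnit M \<otimes> Idn C (MObj M))) \<cdot> (Idn C \<I> \<otimes> x)"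
    by (simp add: convolution_def Comp_assoc_Arr interchange)
  also have "\<dots> = LUnit C (MObj M) \<cdot> (Idn C \<I> \<otimes> x)"
    using monoid by (simp add: monoid_in_def)
  also have "\<dots> = x \<cdot> LUnit C (Dom C x)"
    by (rule LUnit_natural) (simp add: Hom_def)
  finally show "MUnit M \<star> x = x \<cdot> LUnit C (Dom C x)" .
  have "x \<star> MUnit M = (MMult M \<cdot> (Idn C (MObj M) \<otimes> MUnit M)) \<cdot> (x \<otimes> Idn C \<I>)"
    by (simp add: convolution_def Comp_assoc_Arr interchange)
  also have "\<dots> = RUnit C (MObj M) \<cdot> (x \<otimes> Idn C \<I>)"
    using monoid by (simp add: monoid_in_def)
  also have "\<dots> = x \<cdot> RUnit C (Dom C x)"
    by (rule RUnit_natural) (simp add: Hom_def)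
  finally show "x \<star> MUnit M = x \<cdot> RUnit C (Dom C x)" .
qed

end

context monoidal_category
begin

lemma monoid_morphism_convolution:
  assumes "monoid_in C M" "monoid_in C N" "monoid_morphism C M N h"
    "x \<in> Arr C" "y \<in> Arr C" "Cod C x = MObj M" "Cod C y = MObj M"
  shows "h \<cdot> convolution C M x y = convolution C N (h \<cdot> x) (h \<cdot> y)"
proof -
  interpret M: monoid_object C M by unfold_locales (rule assms)
  interpret N: monoid_object C N by unfold_locales (rule assms)
  have [simp]: "h \<in> Arr C" "Dom C h = MObj M" "Cod C h = MObj N"
    and h: "h \<cdot> MMult M = MMult N \<cdot> (h \<otimes> h)"
    using assms(3) by (auto simp: monoid_morphism_def Hom_def)
  have "h \<cdot> convolution C M x y = (h \<cdot> MMult M) \<cdot> (x \<otimes> y)"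
    using assms by (simp add: convolution_def Comp_assoc_Arr)
  then show ?thesis using assms by (simp add: h convolution_def Comp_assoc_Arr interchange)
qed

lemma epi_tensor_Idn:
  assumes "tensor_preserves_coequalizers C" "is_coequalizer C f g q" "a \<in> Obj C"
  shows "epi C (Idn C a \<otimes> q)" "epi C (q \<otimes> Idn C a)"
    "b \<in> Obj C \<Longrightarrow> epi C ((Idn C a \<otimes> q) \<otimes> Idn C b)"
    "b \<in> Obj C \<Longrightarrow> epi C ((q \<otimes> Idn C a) \<otimes> Idn C b)"
proof -
  note c = coequalizer_tensor[OF assms]
  show "epi C (Idn C a \<otimes> q)" "epi C (q \<otimes> Idn C a)"
    by (rule c[THEN coequalizer_epi])+
  assume b: "b \<in> Obj C"
  show "epi C ((Idn C a \<otimes> q) \<otimes> Idn C b)"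
    by (rule coequalizer_tensor(2)[OF assms(1) c(1) b, THEN coequalizer_epi])
  show "epi C ((q \<otimes> Idn C a) \<otimes> Idn C b)"
    by (rule coequalizer_tensor(2)[OF assms(1) c(2) b, THEN coequalizer_epi])
qed

text \<open>If \<open>c\<close> is the quotient of \<open>a\<close> by a relation, then \<open>c \<otimes> c\<close> is the quotient of \<open>a \<otimes> a\<close> by that
  relation in each variable. The arrow \<open>n\<close> is factored first through \<open>a \<otimes> c\<close> and the result then
  through \<open>c \<otimes> q\<close>, where \<open>q\<close> is the codomain of \<open>c\<close>; for the second step the relation in the left
  variable, known over \<open>a\<close>, is carried over to \<open>q\<close> by cancelling an epimorphism.\<close>

lemma coequalizer_square:
  assumes pres: "tensor_preserves_coequalizers C" and c: "is_coequalizer C p p' c"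
    and p [simp]: "p \<in> Arr C" "p' \<in> Arr C" "Dom C p' = Dom C p" "Cod C p = a" "Cod C p' = a"
    and c' [simp]: "c \<in> Arr C" "Dom C c = a"
    and n [simp]: "n \<in> Arr C" "Dom C n = a \<otimes>\<^sub>o a"
    and nl: "n \<cdot> (Idn C a \<otimes> p) = n \<cdot> (Idn C a \<otimes> p')"
    and nr: "n \<cdot> (p \<otimes> Idn C a) = n \<cdot> (p' \<otimes> Idn C a)"
  shows "\<exists>k \<in> Arr C. Dom C k = Cod C c \<otimes>\<^sub>o Cod C c \<and> Cod C k = Cod C n \<and> k \<cdot> (c \<otimes> c) = n"
proof -
  have a [simp]: "a \<in> Obj C" using Dom_Obj[OF c'(1)] by simp
  let ?Y = "Dom C p" and ?q = "Cod C c"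
  obtain n' where n' [simp]: "n' \<in> Arr C" "Dom C n' = a \<otimes>\<^sub>o ?q" "Cod C n' = Cod C n"
    and n'n: "n' \<cdot> (Idn C a \<otimes> c) = n"
    using coequalizer_factor[OF coequalizer_tensor(1)[OF pres c a] n(1) _ nl] by (auto simp: c')
  have "epi C (Idn C ?Y \<otimes> c)" using coequalizer_epi[OF coequalizer_tensor(1)[OF pres c]] by simp
  moreover have "(n' \<cdot> (p1 \<otimes> Idn C ?q)) \<cdot> (Idn C ?Y \<otimes> c) = n \<cdot> (p1 \<otimes> Idn C a)"
    if [simp]: "p1 \<in> Arr C" "Dom C p1 = ?Y" "Cod C p1 = a" for p1
    by (simp add: Comp_assoc_Arr interchange flip: n'n)
  ultimately have "n' \<cdot> (p \<otimes> Idn C ?q) = n' \<cdot> (p' \<otimes> Idn C ?q)"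
    using nr by (auto elim!: epi_cancel)
  then obtain k where k [simp]: "k \<in> Arr C" "Dom C k = ?q \<otimes>\<^sub>o ?q" "Cod C k = Cod C n"
    and kn: "k \<cdot> (c \<otimes> Idn C ?q) = n'"
    using coequalizer_factor[OF coequalizer_tensor(2)[OF pres c, of ?q] n'(1)] by auto
  have "k \<cdot> (c \<otimes> c) = n"
    unfolding n'n[symmetric] kn[symmetric] by (simp add: Comp_assoc_Arr interchange)
  then show ?thesis using k by blast
qed

text \<open>A monoid structure descends along \<open>c\<close> as soon as its multiplication does: each monoid law on the
  quotient can be checked after composing with a tensor product of copies of \<open>c\<close> and identities,
  which is epi, and there it is the corresponding law of \<open>M\<close>.\<close>

lemma monoid_on_quotient:
  assumes pres: "tensor_preserves_coequalizers C" and c: "is_coequalizer C p p' c"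
    and M: "monoid_in C M" and [simp]: "Dom C c = MObj M"
    and n [simp]: "n \<in> Arr C" "Dom C n = Cod C c \<otimes>\<^sub>o Cod C c" "Cod C n = Cod C c"
    and nc: "n \<cdot> (c \<otimes> c) = c \<cdot> MMult M"
  defines "Q \<equiv> \<lparr>MObj = Cod C c, MMult = n, MUnit = c \<cdot> MUnit M\<rparr>"
  shows "monoid_in C Q" "monoid_morphism C M Q c"
proof -
  interpret M: monoid_object C M by unfold_locales (rule M)
  note ep = coequalizer_epi[OF c]
  have [simp]: "c \<in> Arr C" using ep by (rule epi_Arr)
  let ?q = "Cod C c" and ?a = "MObj M"
  have nc': "n \<cdot> ((c \<cdot> x) \<otimes> (c \<cdot> y)) = c \<cdot> convolution C M x y"
    if [simp]: "x \<in> Arr C" "y \<in> Arr C" "Cod C x = ?a" "Cod C y = ?a" for x y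
  proof -
    have "n \<cdot> ((c \<cdot> x) \<otimes> (c \<cdot> y)) = (n \<cdot> (c \<otimes> c)) \<cdot> (x \<otimes> y)"
      by (simp add: Comp_assoc_Arr interchange)
    also have "\<dots> = c \<cdot> convolution C M x y"
      unfolding nc by (simp add: convolution_def Comp_assoc_Arr)
    finally show ?thesis .
  qed
  have e3: "epi C ((c \<otimes> c) \<otimes> c)"
  proof -
    \<comment> \<open>One factor at a time: the tensor product is known to preserve coequalizers in each variable
      separately.\<close>
    have 1: "epi C ((Idn C ?a \<otimes> c) \<otimes> Idn C ?a)"
      by (simp add: epi_tensor_Idn[OF pres c])
    have 2: "epi C ((c \<otimes> Idn C ?q) \<otimes> Idn C ?a)"
      by (simp add: epi_tensor_Idn[OF pres c])
    have 3: "epi C (Idn C (?q \<otimes>\<^sub>o ?q) \<otimes> c)"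
      by (simp add: epi_tensor_Idn[OF pres c])
    have "epi C ((Idn C (?q \<otimes>\<^sub>o ?q) \<otimes> c) \<cdot> (((c \<otimes> Idn C ?q) \<otimes> Idn C ?a) \<cdot> ((Idn C ?a \<otimes> c) \<otimes> Idn C ?a)))"
      by (intro epi_Comp 1 2 3) simp_all
    then show ?thesis by (simp add: interchange)
  qed
  have ass: "n \<cdot> (n \<otimes> Idn C ?q) = n \<cdot> (Idn C ?q \<otimes> n) \<cdot> Assoc C ?q ?q ?q"
  proof (rule epi_cancel[OF e3])
    have "n \<cdot> (n \<otimes> Idn C ?q) \<cdot> ((c \<otimes> c) \<otimes> c) = n \<cdot> ((c \<cdot> MMult M) \<otimes> (c \<cdot> Idn C ?a))"
      by (simp add: Comp_assoc_Arr interchange nc)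
    also have "\<dots> = c \<cdot> convolution C M (MMult M) (Idn C ?a)" by (rule nc') simp_all
    also have "\<dots> = c \<cdot> (convolution C M (Idn C ?a) (MMult M) \<cdot> Assoc C ?a ?a ?a)"
      using M by (simp add: monoid_in_def convolution_def)
    also have "\<dots> = (c \<cdot> convolution C M (Idn C ?a) (MMult M)) \<cdot> Assoc C ?a ?a ?a"
      by (simp add: Comp_assoc_Arr)
    also have "\<dots> = (n \<cdot> ((c \<cdot> Idn C ?a) \<otimes> (c \<cdot> MMult M))) \<cdot> Assoc C ?a ?a ?a"
      by (subst nc') simp_all
    also have "\<dots> = n \<cdot> ((Idn C ?q \<otimes> n) \<cdot> (c \<otimes> (c \<otimes> c))) \<cdot> Assoc C ?a ?a ?a"
      by (simp add: interchange nc)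
    also have "\<dots> = n \<cdot> (Idn C ?q \<otimes> n) \<cdot> ((c \<otimes> (c \<otimes> c)) \<cdot> Assoc C ?a ?a ?a)"
      by (simp add: Comp_assoc_Arr)
    also have "\<dots> = n \<cdot> (Idn C ?q \<otimes> n) \<cdot> (Assoc C ?q ?q ?q \<cdot> ((c \<otimes> c) \<otimes> c))"
      using Assoc_natural_Arr[of c c c] by simp
    also have "\<dots> = n \<cdot> (Idn C ?q \<otimes> n) \<cdot> Assoc C ?q ?q ?q \<cdot> ((c \<otimes> c) \<otimes> c)"
      by (simp add: Comp_assoc_Arr)
    finally show "n \<cdot> (n \<otimes> Idn C ?q) \<cdot> ((c \<otimes> c) \<otimes> c) = \<dots>" .
  qed simp_all
  have lu: "n \<cdot> ((c \<cdot> MUnit M) \<otimes> Idn C ?q) = LUnit C ?q"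
  proof (rule epi_cancel)
    show "epi C (Idn C \<I> \<otimes> c)" by (simp add: epi_tensor_Idn[OF pres c])
    have "n \<cdot> ((c \<cdot> MUnit M) \<otimes> Idn C ?q) \<cdot> (Idn C \<I> \<otimes> c) = n \<cdot> ((c \<cdot> MUnit M) \<otimes> (c \<cdot> Idn C ?a))"
      by (simp add: Comp_assoc_Arr interchange)
    also have "\<dots> = c \<cdot> LUnit C ?a"
      by (subst nc') (simp_all add: M.convolution_unit)
    also have "\<dots> = LUnit C ?q \<cdot> (Idn C \<I> \<otimes> c)"
      by (rule LUnit_natural[symmetric]) (simp add: Hom_def)
    finally show "n \<cdot> ((c \<cdot> MUnit M) \<otimes> Idn C ?q) \<cdot> (Idn C \<I> \<otimes> c) = \<dots>" .
  qed simp_all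
  have ru: "n \<cdot> (Idn C ?q \<otimes> (c \<cdot> MUnit M)) = RUnit C ?q"
  proof (rule epi_cancel)
    show "epi C (c \<otimes> Idn C \<I>)" by (simp add: epi_tensor_Idn[OF pres c])
    have "n \<cdot> (Idn C ?q \<otimes> (c \<cdot> MUnit M)) \<cdot> (c \<otimes> Idn C \<I>) = n \<cdot> ((c \<cdot> Idn C ?a) \<otimes> (c \<cdot> MUnit M))"
      by (simp add: Comp_assoc_Arr interchange)
    also have "\<dots> = c \<cdot> RUnit C ?a"
      by (subst nc') (simp_all add: M.convolution_unit)
    also have "\<dots> = RUnit C ?q \<cdot> (c \<otimes> Idn C \<I>)"
      by (rule RUnit_natural[symmetric]) (simp add: Hom_def)
    finally show "n \<cdot> (Idn C ?q \<otimes> (c \<cdot> MUnit M)) \<cdot> (c \<otimes> Idn C \<I>) = \<dots>" .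
  qed simp_all
  show "monoid_in C Q"
    by (simp add: monoid_in_def Q_def Hom_def ass lu ru)
  show "monoid_morphism C M Q c"
    by (simp add: monoid_morphism_def Q_def Hom_def nc)
qed

end

section \<open>Quotients of monoids by two-sided ideals\<close>

text \<open>The universal monoid under \<open>A\<close> in which the two arrows of every pair in \<open>S\<close> become equal. The arrows
  in \<open>S\<close> are arrows of \<open>C\<close>, not morphisms of monoids. A coequalizer in \<open>Mon C\<close> is the special case
  of one pair of monoid morphisms.\<close>

definition monoid_quotient where
  "monoid_quotient C S A Q q \<longleftrightarrow> q \<in> Hom (Mon C) A Q \<and>
    (\<forall>(f, g) \<in> S. MMap q \<cdot>\<^bsub>C\<^esub> f = MMap q \<cdot>\<^bsub>C\<^esub> g) \<and>
    (\<forall>N. \<forall>h \<in> Hom (Mon C) A N. (\<forall>(f, g) \<in> S. MMap h \<cdot>\<^bsub>C\<^esub> f = MMap h \<cdot>\<^bsub>C\<^esub> g) \<longrightarrow>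
      (\<exists>!k. k \<in> Hom (Mon C) Q N \<and> k \<cdot>\<^bsub>Mon C\<^esub> q = h))"

text \<open>Rebracketing to the left needs the inverse associator; one arrow \<open>\<beta>\<close> serves all generalized elements with the same domains.\<close>

lemma (in monoid_object) convolution_assoc_inverse:
  assumes "a \<in> Obj C" "b \<in> Obj C" "c \<in> Obj C"
  obtains \<beta> where "\<beta> \<in> Arr C" "Dom C \<beta> = a \<otimes>\<^sub>o (b \<otimes>\<^sub>o c)" "Cod C \<beta> = (a \<otimes>\<^sub>o b) \<otimes>\<^sub>o c"
    "\<And>x y z. \<lbrakk>x \<in> Hom C a (MObj M); y \<in> Hom C b (MObj M); z \<in> Hom C c (MObj M)\<rbrakk>
      \<Longrightarrow> x \<star> (y \<star> z) = ((x \<star> y) \<star> z) \<cdot> \<beta>"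
proof -
  obtain \<beta> where "\<beta> \<in> Hom C (a \<otimes>\<^sub>o (b \<otimes>\<^sub>o c)) ((a \<otimes>\<^sub>o b) \<otimes>\<^sub>o c)"
    and inv: "Assoc C a b c \<cdot> \<beta> = Idn C (a \<otimes>\<^sub>o (b \<otimes>\<^sub>o c))"
    using Assoc_iso[OF assms] by (auto simp: iso_in_def)
  then have \<beta> [simp]: "\<beta> \<in> Arr C" "Dom C \<beta> = a \<otimes>\<^sub>o (b \<otimes>\<^sub>o c)" "Cod C \<beta> = (a \<otimes>\<^sub>o b) \<otimes>\<^sub>o c"
    by (auto simp: Hom_def)
  have "x \<star> (y \<star> z) = ((x \<star> y) \<star> z) \<cdot> \<beta>"
    if "x \<in> Hom C a (MObj M)" "y \<in> Hom C b (MObj M)" "z \<in> Hom C c (MObj M)" for x y z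
  proof -
    note [simp] = that[unfolded Hom_def, simplified] assms
    show ?thesis by (simp add: convolution_assoc Comp_assoc_Arr inv)
  qed
  with \<beta> show ?thesis by (rule that)
qed

text \<open>The arrow \<open>p f\<close>, in elements \<open>(b, x, b') \<mapsto> b f(x) b'\<close>, is the bimodule map
  that \<open>f\<close> induces on the free bimodule over its domain. Hence
  identifying \<open>p f\<close> with \<open>p g\<close> is imposing the two-sided ideal generated by \<open>f = g\<close>: it identifies
  all products \<open>x f y\<close> with \<open>x g y\<close>. Multiplying \<open>p f\<close> by a further factor on either side only
  enlarges \<open>x\<close> or \<open>y\<close>, and \<open>f\<close> itself is the product with \<open>x\<close> and \<open>y\<close> equal to the unit.\<close>

lemma (in monoid_object) two_sided_ideal:
  fixes f :: 'a
  defines "p \<equiv> \<lambda>f. (Idn C (MObj M) \<star> f) \<star> Idn C (MObj M)"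
  assumes f [simp]: "f \<in> Arr C" "Cod C f = MObj M" and g [simp]: "g \<in> Arr C" "Dom C g = Dom C f"
    "Cod C g = MObj M"
    and c [simp]: "c \<in> Arr C" "Dom C c = MObj M" and cp: "c \<cdot> p f = c \<cdot> p g"
  shows "c \<cdot> (Idn C (MObj M) \<star> p f) = c \<cdot> (Idn C (MObj M) \<star> p g)"
    and "c \<cdot> (p f \<star> Idn C (MObj M)) = c \<cdot> (p g \<star> Idn C (MObj M))"
    and "c \<cdot> f = c \<cdot> g"
proof -
  let ?a = "MObj M" and ?x = "Dom C f"
  let ?i = "Idn C ?a"
  have x [simp]: "?x \<in> Obj C" by simp
  \<comment> \<open>The factors \<open>x\<close> and \<open>y\<close> can be pulled out of the generating case, where they are identities.\<close>
  have sandwich: "c \<cdot> ((x \<star> f) \<star> y) = c \<cdot> ((x \<star> g) \<star> y)"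
    if [simp]: "x \<in> Arr C" "y \<in> Arr C" "Cod C x = ?a" "Cod C y = ?a" for x y
  proof -
    have "(x \<star> t) \<star> y = p t \<cdot> ((x \<otimes> Idn C ?x) \<otimes> y)"
      if [simp]: "t \<in> Arr C" "Dom C t = ?x" "Cod C t = ?a" for t
      by (simp add: p_def flip: convolution_Comp)
    then have "c \<cdot> ((x \<star> t) \<star> y) = (c \<cdot> p t) \<cdot> ((x \<otimes> Idn C ?x) \<otimes> y)"
      if [simp]: "t \<in> Arr C" "Dom C t = ?x" "Cod C t = ?a" for t
      by (simp add: p_def Comp_assoc_Arr)
    then show ?thesis using cp by simp
  qed
  obtain \<beta> where \<beta> [simp]: "\<beta> \<in> Arr C" "Dom C \<beta> = ?a \<otimes>\<^sub>o ((?a \<otimes>\<^sub>o ?x) \<otimes>\<^sub>o ?a)"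
      "Cod C \<beta> = (?a \<otimes>\<^sub>o (?a \<otimes>\<^sub>o ?x)) \<otimes>\<^sub>o ?a"
    and \<beta>_assoc: "\<And>x y z. \<lbrakk>x \<in> Hom C ?a ?a; y \<in> Hom C (?a \<otimes>\<^sub>o ?x) ?a; z \<in> Hom C ?a ?a\<rbrakk>
      \<Longrightarrow> x \<star> (y \<star> z) = ((x \<star> y) \<star> z) \<cdot> \<beta>"
    by (rule convolution_assoc_inverse[of ?a "?a \<otimes>\<^sub>o ?x" ?a]) simp_all
  obtain \<gamma> where \<gamma> [simp]: "\<gamma> \<in> Arr C" "Dom C \<gamma> = ?a \<otimes>\<^sub>o (?a \<otimes>\<^sub>o ?x)"
      "Cod C \<gamma> = (?a \<otimes>\<^sub>o ?a) \<otimes>\<^sub>o ?x"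
    and \<gamma>_assoc: "\<And>x y z. \<lbrakk>x \<in> Hom C ?a ?a; y \<in> Hom C ?a ?a; z \<in> Hom C ?x ?a\<rbrakk>
      \<Longrightarrow> x \<star> (y \<star> z) = ((x \<star> y) \<star> z) \<cdot> \<gamma>"
    by (rule convolution_assoc_inverse[of ?a ?a ?x]) simp_all
  have "c \<cdot> (?i \<star> p t) = (c \<cdot> (((?i \<star> ?i) \<star> t) \<star> ?i)) \<cdot> ((\<gamma> \<otimes> ?i) \<cdot> \<beta>)"
    if [simp]: "t \<in> Arr C" "Dom C t = ?x" "Cod C t = ?a" for t
  proof -
    have "?i \<star> p t = ((?i \<star> (?i \<star> t)) \<star> ?i) \<cdot> \<beta>"
      unfolding p_def by (rule \<beta>_assoc) (simp_all add: Hom_def)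
    also have "?i \<star> (?i \<star> t) = ((?i \<star> ?i) \<star> t) \<cdot> \<gamma>"
      by (rule \<gamma>_assoc) (simp_all add: Hom_def)
    also have "\<dots> \<star> ?i = (((?i \<star> ?i) \<star> t) \<star> ?i) \<cdot> (\<gamma> \<otimes> ?i)"
      by (simp flip: convolution_Comp)
    finally show ?thesis by (simp add: Comp_assoc_Arr)
  qed
  then show "c \<cdot> (?i \<star> p f) = c \<cdot> (?i \<star> p g)"
    using sandwich[of "?i \<star> ?i" ?i] by simp
  have "c \<cdot> (p t \<star> ?i) = (c \<cdot> ((?i \<star> t) \<star> (?i \<star> ?i))) \<cdot> Assoc C (?a \<otimes>\<^sub>o ?x) ?a ?a"
    if [simp]: "t \<in> Arr C" "Dom C t = ?x" "Cod C t = ?a" for t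
    unfolding p_def by (subst convolution_assoc) (simp_all add: Comp_assoc_Arr)
  then show "c \<cdot> (p f \<star> ?i) = c \<cdot> (p g \<star> ?i)"
    using sandwich[of ?i "?i \<star> ?i"] by simp
  show "c \<cdot> f = c \<cdot> g"
  proof (rule epi_cancel)
    show "epi C (LUnit C ?x \<cdot> RUnit C (\<I> \<otimes>\<^sub>o ?x))"
      by (intro epi_Comp epi_iso[OF LUnit_iso] epi_iso[OF RUnit_iso]) simp_all
    have "(MUnit M \<star> t) \<star> MUnit M = t \<cdot> (LUnit C ?x \<cdot> RUnit C (\<I> \<otimes>\<^sub>o ?x))"
      if [simp]: "t \<in> Arr C" "Dom C t = ?x" "Cod C t = ?a" for t
      by (simp add: convolution_unit Comp_assoc_Arr)
    then show "c \<cdot> f \<cdot> (LUnit C ?x \<cdot> RUnit C (\<I> \<otimes>\<^sub>o ?x)) = c \<cdot> g \<cdot> (LUnit C ?x \<cdot> RUnit C (\<I> \<otimes>\<^sub>o ?x))"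
      using sandwich[of "MUnit M" "MUnit M"] by (simp add: Comp_assoc_Arr)
  qed simp_all
qed

context monoidal_category
begin

text \<open>The laws for \<open>k\<close> are those for \<open>h\<close> after composing with \<open>q \<otimes> q\<close>, which can be cancelled.\<close>

lemma monoid_morphism_descends:
  assumes M: "monoid_in C M" and N: "monoid_in C N" and Q: "monoid_in C Q"
    and q: "monoid_morphism C M Q q" and h: "monoid_morphism C M N h"
    and ep: "epi C (q \<otimes> q)" and k [simp]: "k \<in> Arr C" "Dom C k = MObj Q" "Cod C k = MObj N"
    and kq: "k \<cdot> q = h"
  shows "monoid_morphism C Q N k"
proof -
  interpret M: monoid_object C M by unfold_locales (rule M)
  interpret N: monoid_object C N by unfold_locales (rule N)
  interpret Q: monoid_object C Q by unfold_locales (rule Q)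
  have [simp]: "q \<in> Arr C" "Dom C q = MObj M" "Cod C q = MObj Q"
    and qm: "q \<cdot> MMult M = MMult Q \<cdot> (q \<otimes> q)" and qe: "q \<cdot> MUnit M = MUnit Q"
    using q by (auto simp: monoid_morphism_def Hom_def)
  have hm: "h \<cdot> MMult M = MMult N \<cdot> (h \<otimes> h)" and he: "h \<cdot> MUnit M = MUnit N"
    using h by (auto simp: monoid_morphism_def)
  have "k \<cdot> MMult Q = MMult N \<cdot> (k \<otimes> k)"
  proof (rule epi_cancel[OF ep])
    have "k \<cdot> MMult Q \<cdot> (q \<otimes> q) = (k \<cdot> q) \<cdot> MMult M"
      by (simp add: Comp_assoc_Arr qm)
    also have "\<dots> = MMult N \<cdot> (k \<otimes> k) \<cdot> (q \<otimes> q)"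
      by (simp add: kq hm Comp_assoc_Arr interchange)
    finally show "k \<cdot> MMult Q \<cdot> (q \<otimes> q) = \<dots>" .
  qed simp_all
  moreover have "k \<cdot> MUnit Q = MUnit N"
    using he by (simp add: Comp_assoc_Arr flip: qe kq)
  ultimately show ?thesis by (simp add: monoid_morphism_def Hom_def)
qed

text \<open>The coequalizer \<open>c\<close> in \<open>C\<close> of the bimodule maps induced by \<open>f\<close> and \<open>g\<close> carries the required monoid: the
  ideal property makes the multiplication descend along \<open>c\<close>, and a monoid morphism that identifies
  \<open>f\<close> and \<open>g\<close> identifies the bimodule maps too, so it factors through \<open>c\<close>.\<close>

lemma monoid_quotient_pair:
  assumes pres: "tensor_preserves_coequalizers C" and coeq: "has_coequalizers C"
    and A: "monoid_in C A" and f: "f \<in> Hom C x (MObj A)" and g: "g \<in> Hom C x (MObj A)"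
  shows "\<exists>Q q. monoid_quotient C {(f, g)} A Q q"
proof -
  interpret A: monoid_object C A by unfold_locales (rule A)
  have fg [simp]: "f \<in> Arr C" "Dom C f = x" "Cod C f = MObj A"
    "g \<in> Arr C" "Dom C g = x" "Cod C g = MObj A"
    using f g by (auto simp: Hom_def)
  let ?a = "MObj A"
  let ?i = "Idn C ?a"
  define p where "p t = convolution C A (convolution C A ?i t) ?i" for t
  have p [simp]: "p t \<in> Arr C" "Dom C (p t) = (?a \<otimes>\<^sub>o x) \<otimes>\<^sub>o ?a" "Cod C (p t) = ?a"
    if "t \<in> Arr C" "Dom C t = x" "Cod C t = ?a" for t
    using that by (simp_all add: p_def)
  have "p f \<in> Hom C ((?a \<otimes>\<^sub>o x) \<otimes>\<^sub>o ?a) ?a" "p g \<in> Hom C ((?a \<otimes>\<^sub>o x) \<otimes>\<^sub>o ?a) ?a"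
    by (simp_all add: Hom_def)
  then obtain c where c: "is_coequalizer C (p f) (p g) c"
    using coeq unfolding has_coequalizers_def by blast
  have [simp]: "c \<in> Arr C" "Dom C c = ?a" and cp: "c \<cdot> p f = c \<cdot> p g"
    using coequalizer_Arr[OF c] by simp_all
  note ideal = A.two_sided_ideal[of f g c, folded p_def]
  have "\<exists>n \<in> Arr C. Dom C n = Cod C c \<otimes>\<^sub>o Cod C c \<and> Cod C n = Cod C (c \<cdot> MMult A)
      \<and> n \<cdot> (c \<otimes> c) = c \<cdot> MMult A"
  proof (rule coequalizer_square[OF pres c, of ?a])
    show "c \<cdot> MMult A \<cdot> (?i \<otimes> p f) = c \<cdot> MMult A \<cdot> (?i \<otimes> p g)"
      using ideal(1) cp by (simp add: convolution_def Comp_assoc_Arr)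
    show "c \<cdot> MMult A \<cdot> (p f \<otimes> ?i) = c \<cdot> MMult A \<cdot> (p g \<otimes> ?i)"
      using ideal(2) cp by (simp add: convolution_def Comp_assoc_Arr)
  qed simp_all
  then obtain n where n [simp]: "n \<in> Arr C" "Dom C n = Cod C c \<otimes>\<^sub>o Cod C c" "Cod C n = Cod C c"
    and nc: "n \<cdot> (c \<otimes> c) = c \<cdot> MMult A" by auto
  define Q where "Q = \<lparr>MObj = Cod C c, MMult = n, MUnit = c \<cdot> MUnit A\<rparr>"
  have Q: "monoid_in C Q" and cQ: "monoid_morphism C A Q c"
    unfolding Q_def by (rule monoid_on_quotient[OF pres c A _ n nc]; simp)+
  have MQ [simp]: "MObj Q = Cod C c" by (simp add: Q_def)
  have "epi C ((c \<otimes> Idn C (Cod C c)) \<cdot> (Idn C ?a \<otimes> c))"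
    by (intro epi_Comp epi_tensor_Idn[OF pres c]) simp_all
  then have cc: "epi C (c \<otimes> c)" by (simp add: interchange)
  define q where "q = \<lparr>MSrc = A, MTgt = Q, MMap = c\<rparr>"
  have q: "q \<in> Hom (Mon C) A Q" using A Q cQ by (simp add: Mon_Hom q_def)
  have "\<exists>!k. k \<in> Hom (Mon C) Q N \<and> k \<cdot>\<^bsub>Mon C\<^esub> q = h"
    if h: "h \<in> Hom (Mon C) A N" and hfg: "MMap h \<cdot> f = MMap h \<cdot> g" for N h
  proof -
    have N: "monoid_in C N" and hN: "monoid_morphism C A N (MMap h)"
      and st: "MSrc h = A" "MTgt h = N" using h by (auto simp: Mon_Hom)
    have [simp]: "MMap h \<in> Arr C" "Dom C (MMap h) = ?a" "Cod C (MMap h) = MObj N"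
      using hN by (auto simp: monoid_morphism_def Hom_def)
    have hp: "MMap h \<cdot> p t = convolution C N (convolution C N (MMap h) (MMap h \<cdot> t)) (MMap h)"
      if [simp]: "t \<in> Arr C" "Cod C t = ?a" for t
      by (simp add: p_def monoid_morphism_convolution[OF A N hN])
    have "MMap h \<cdot> p f = MMap h \<cdot> p g" by (simp add: hp hfg)
    then obtain k where k [simp]: "k \<in> Arr C" "Dom C k = Cod C c" "Cod C k = MObj N"
      and kc: "k \<cdot> c = MMap h"
      using coequalizer_factor[OF c, of "MMap h"] by auto
    have kN: "monoid_morphism C Q N k"
      by (rule monoid_morphism_descends[OF A N Q cQ hN cc _ _ _ kc]) simp_all
    show ?thesis
    proof (intro ex1I conjI)
      show "\<lparr>MSrc = Q, MTgt = N, MMap = k\<rparr> \<in> Hom (Mon C) Q N"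
        using Q N kN by (simp add: Mon_Hom)
      show "\<lparr>MSrc = Q, MTgt = N, MMap = k\<rparr> \<cdot>\<^bsub>Mon C\<^esub> q = h"
        using st kc by (simp add: q_def)
      fix k' assume k': "k' \<in> Hom (Mon C) Q N \<and> k' \<cdot>\<^bsub>Mon C\<^esub> q = h"
      then have k'Q [simp]: "MMap k' \<in> Arr C" "Dom C (MMap k') = Cod C c"
        and "MMap k' \<cdot> c = MMap h"
        by (auto simp: Mon_Hom monoid_morphism_def q_def) (auto simp: Hom_def)
      then have "MMap k' = k"
        using epi_cancel[OF coequalizer_epi[OF c], of "MMap k'" k] kc by simp
      then show "k' = \<lparr>MSrc = Q, MTgt = N, MMap = k\<rparr>"
        using k' by (auto simp: Mon_Hom)
    qed
  qed
  moreover have "c \<cdot> f = c \<cdot> g" using ideal(3) cp by simp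
  ultimately have "monoid_quotient C {(f, g)} A Q q"
    using q by (simp add: monoid_quotient_def q_def)
  then show ?thesis by blast
qed

text \<open>Pairs can be imposed one at a time: after dividing by \<open>S\<close>, divide by the image of the new pair.\<close>

lemma monoid_quotient_insert:
  assumes pres: "tensor_preserves_coequalizers C" and coeq: "has_coequalizers C"
    and A: "monoid_in C A" and Q: "monoid_quotient C S A Q q"
    and f: "f \<in> Hom C x (MObj A)" and g: "g \<in> Hom C x (MObj A)"
    and S: "\<And>s t. (s, t) \<in> S \<Longrightarrow> \<exists>y. s \<in> Hom C y (MObj A) \<and> t \<in> Hom C y (MObj A)"
  shows "\<exists>Q' q'. monoid_quotient C (insert (f, g) S) A Q' q'"
proof -
  interpret MonC: category "Mon C" by (rule category_Mon)
  have q: "q \<in> Hom (Mon C) A Q" and qS: "\<And>s t. (s, t) \<in> S \<Longrightarrow> MMap q \<cdot> s = MMap q \<cdot> t"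
    and uq: "\<And>N h. h \<in> Hom (Mon C) A N \<Longrightarrow> \<forall>(s, t) \<in> S. MMap h \<cdot> s = MMap h \<cdot> t
      \<Longrightarrow> \<exists>!k. k \<in> Hom (Mon C) Q N \<and> k \<cdot>\<^bsub>Mon C\<^esub> q = h"
    using Q unfolding monoid_quotient_def by blast+
  have MQ: "monoid_in C Q" and q': "MMap q \<in> Hom C (MObj A) (MObj Q)"
    using q by (auto simp: Mon_Hom monoid_morphism_def)
  obtain P p where P: "monoid_quotient C {(MMap q \<cdot> f, MMap q \<cdot> g)} Q P p"
    using monoid_quotient_pair[OF pres coeq MQ Comp_Hom[OF f q'] Comp_Hom[OF g q']] by blast
  have p: "p \<in> Hom (Mon C) Q P" and pfg: "MMap p \<cdot> (MMap q \<cdot> f) = MMap p \<cdot> (MMap q \<cdot> g)"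
    and up: "\<And>N h. h \<in> Hom (Mon C) Q N \<Longrightarrow> MMap h \<cdot> (MMap q \<cdot> f) = MMap h \<cdot> (MMap q \<cdot> g)
      \<Longrightarrow> \<exists>!k. k \<in> Hom (Mon C) P N \<and> k \<cdot>\<^bsub>Mon C\<^esub> p = h"
    using P unfolding monoid_quotient_def by simp_all
  have kq: "MMap (k \<cdot>\<^bsub>Mon C\<^esub> q) \<cdot> t = MMap k \<cdot> (MMap q \<cdot> t)"
    if "k \<in> Hom (Mon C) Q N" "t \<in> Hom C y (MObj A)" for k N t y
    using that Comp_assoc[OF that(2) q', of "MMap k" "MObj N"]
    by (simp add: Mon_Hom monoid_morphism_def)
  have pq: "p \<cdot>\<^bsub>Mon C\<^esub> q \<in> Hom (Mon C) A P" using q p by (rule MonC.Comp_Hom)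
  have "monoid_quotient C (insert (f, g) S) A P (p \<cdot>\<^bsub>Mon C\<^esub> q)"
    unfolding monoid_quotient_def
  proof (intro conjI allI ballI impI pq)
    fix st assume st: "st \<in> insert (f, g) S"
    obtain s t where [simp]: "st = (s, t)" by (cases st)
    have "\<exists>y. s \<in> Hom C y (MObj A) \<and> t \<in> Hom C y (MObj A)" using st S f g by auto
    then have "MMap (p \<cdot>\<^bsub>Mon C\<^esub> q) \<cdot> s = MMap p \<cdot> (MMap q \<cdot> s)"
      "MMap (p \<cdot>\<^bsub>Mon C\<^esub> q) \<cdot> t = MMap p \<cdot> (MMap q \<cdot> t)"
      using kq[OF p] by blast+
    then show "case st of (s, t) \<Rightarrow> MMap (p \<cdot>\<^bsub>Mon C\<^esub> q) \<cdot> s = MMap (p \<cdot>\<^bsub>Mon C\<^esub> q) \<cdot> t"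
      using st pfg qS by auto
  next
    fix N h assume h: "h \<in> Hom (Mon C) A N"
      and hS: "\<forall>(s, t) \<in> insert (f, g) S. MMap h \<cdot> s = MMap h \<cdot> t"
    have "\<exists>!k. k \<in> Hom (Mon C) Q N \<and> k \<cdot>\<^bsub>Mon C\<^esub> q = h" using uq[OF h] hS by simp
    then obtain k where k: "k \<in> Hom (Mon C) Q N" "k \<cdot>\<^bsub>Mon C\<^esub> q = h"
      and k_uniq: "\<And>k'. k' \<in> Hom (Mon C) Q N \<Longrightarrow> k' \<cdot>\<^bsub>Mon C\<^esub> q = h \<Longrightarrow> k' = k"
      by (elim ex1E) blast
    have "MMap k \<cdot> (MMap q \<cdot> f) = MMap k \<cdot> (MMap q \<cdot> g)"
      using kq[OF k(1) f] kq[OF k(1) g] hS unfolding k(2) by simp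
    from up[OF k(1) this] obtain l where l: "l \<in> Hom (Mon C) P N" "l \<cdot>\<^bsub>Mon C\<^esub> p = k"
      and l_uniq: "\<And>l'. l' \<in> Hom (Mon C) P N \<Longrightarrow> l' \<cdot>\<^bsub>Mon C\<^esub> p = k \<Longrightarrow> l' = l"
      by (elim ex1E) blast
    show "\<exists>!l. l \<in> Hom (Mon C) P N \<and> l \<cdot>\<^bsub>Mon C\<^esub> (p \<cdot>\<^bsub>Mon C\<^esub> q) = h"
    proof (intro ex1I conjI)
      show "l \<in> Hom (Mon C) P N" by (rule l)
      show "l \<cdot>\<^bsub>Mon C\<^esub> (p \<cdot>\<^bsub>Mon C\<^esub> q) = h"
        using MonC.Comp_assoc[OF q p l(1)] unfolding l(2) k(2) by (rule sym)
      fix l' assume l': "l' \<in> Hom (Mon C) P N \<and> l' \<cdot>\<^bsub>Mon C\<^esub> (p \<cdot>\<^bsub>Mon C\<^esub> q) = h"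
      then have "l' \<cdot>\<^bsub>Mon C\<^esub> p = k"
        using k_uniq[OF MonC.Comp_Hom[OF p]] MonC.Comp_assoc[OF q p] by metis
      then show "l' = l" using l_uniq l' by blast
    qed
  qed
  then show ?thesis by blast
qed

end

section \<open>The left adjoint of the induced functor\<close>

text \<open>Composing the universal arrows of \<open>R\<close> and of the forgetful functor gives an arrow \<open>u\<close> from the object of
  \<open>B\<close> to \<open>R A\<close> that is universal among arrows into values of \<open>R\<close> on monoids, but need not be a morphism of monoids. The
  equations that \<open>u\<close> may violate are \<open>s1 = t1\<close> (multiplication) and \<open>s2 = t2\<close> (unit). As \<open>R h\<close> is a
  monoid morphism, \<open>R h \<cdot> u\<close> is one if and only if \<open>R h\<close> equalizes these pairs, that is, if and only
  if \<open>h\<close> equalizes their transposes. So the quotient of \<open>A\<close> by the transposed pairs is universal.\<close>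

lemma (in lax_monoidal_functor) universal_arrow_induced:
  assumes pres: "tensor_preserves_coequalizers C" and coeq: "has_coequalizers C"
    and R: "\<And>y. y \<in> Obj D \<Longrightarrow> \<exists>l v. universal_arrow C D R y l v"
    and U: "\<And>x. x \<in> Obj C \<Longrightarrow> \<exists>A v. universal_arrow (Mon C) C forgetful x A v"
    and B: "monoid_in D B"
  shows "\<exists>Q w. universal_arrow (Mon C) (Mon D) (induced_functor D R) B Q w"
proof -
  interpret MC: category "Mon C" by (rule C.category_Mon)
  interpret B: monoid_object D B by unfold_locales (rule B)
  obtain l v where "universal_arrow C D R (MObj B) l v" using R B.MArr(1) by blast
  moreover from this have "l \<in> Obj C" by (simp add: universal_arrow_def)
  then obtain A v' where "universal_arrow (Mon C) C forgetful l A v'" using U by blast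
  ultimately have "\<exists>A u. universal_arrow (Mon C) D (comp_func R forgetful) (MObj B) A u"
    using universal_arrow_comp[OF C.is_functor_forgetful is_functor_axioms] by blast
  then obtain A u where A: "monoid_in C A" and u: "u \<in> Hom D (MObj B) (OMap R (MObj A))"
    and univ: "\<And>N f. monoid_in C N \<Longrightarrow> f \<in> Hom D (MObj B) (OMap R (MObj N))
      \<Longrightarrow> \<exists>!h. h \<in> Hom (Mon C) A N \<and> AMap R (MMap h) \<cdot>\<^bsub>D\<^esub> u = f"
    unfolding universal_arrow_def by (auto simp: comp_func_def forgetful_def)
  interpret A: monoid_object C A by unfold_locales (rule A)
  let ?RA = "induced_mon D R A"
  have RA: "monoid_in D ?RA" by (rule monoid_in_induced[OF A])
  interpret RA: monoid_object D ?RA by unfold_locales (rule RA)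
  have MRA [simp]: "MObj (induced_mon D R N) = OMap R (MObj N)" for N
    by (simp add: induced_mon_def)
  have [simp]: "u \<in> Arr D" "Dom D u = MObj B" "Cod D u = OMap R (MObj A)"
    using u by (auto simp: Hom_def)
  define s1 t1 s2 t2
    where "s1 = u \<cdot>\<^bsub>D\<^esub> MMult B" and "t1 = convolution D ?RA u u"
      and "s2 = u \<cdot>\<^bsub>D\<^esub> MUnit B" and "t2 = MUnit ?RA"
  have st: "s1 \<in> Hom D (MObj B \<otimes>\<^sub>o\<^bsub>D\<^esub> MObj B) (OMap R (MObj A))"
    "t1 \<in> Hom D (MObj B \<otimes>\<^sub>o\<^bsub>D\<^esub> MObj B) (OMap R (MObj A))"
    "s2 \<in> Hom D \<I>\<^bsub>D\<^esub> (OMap R (MObj A))" "t2 \<in> Hom D \<I>\<^bsub>D\<^esub> (OMap R (MObj A))"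
    by (simp_all add: Hom_def s1_def t1_def s2_def t2_def)
  obtain l1 s1' t1' where 1: "s1' \<in> Hom C l1 (MObj A)" "t1' \<in> Hom C l1 (MObj A)"
    "\<And>b h. h \<in> Hom C (MObj A) b \<Longrightarrow>
      AMap R h \<cdot>\<^bsub>D\<^esub> s1 = AMap R h \<cdot>\<^bsub>D\<^esub> t1 \<longleftrightarrow> h \<cdot>\<^bsub>C\<^esub> s1' = h \<cdot>\<^bsub>C\<^esub> t1'"
    using R[of "MObj B \<otimes>\<^sub>o\<^bsub>D\<^esub> MObj B"]
      universal_arrow_transpose_pair[OF is_functor_axioms _ st(1,2) A.MArr(1)] B.MArr(1)
    by (metis D.TObj_Obj)
  obtain l2 s2' t2' where 2: "s2' \<in> Hom C l2 (MObj A)" "t2' \<in> Hom C l2 (MObj A)"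
    "\<And>b h. h \<in> Hom C (MObj A) b \<Longrightarrow>
      AMap R h \<cdot>\<^bsub>D\<^esub> s2 = AMap R h \<cdot>\<^bsub>D\<^esub> t2 \<longleftrightarrow> h \<cdot>\<^bsub>C\<^esub> s2' = h \<cdot>\<^bsub>C\<^esub> t2'"
    using R[of "\<I>\<^bsub>D\<^esub>"]
      universal_arrow_transpose_pair[OF is_functor_axioms _ st(3,4) A.MArr(1)]
    by (metis D.TUnit_Obj)
  let ?S = "{(s1', t1'), (s2', t2')}"
  have iff: "(\<forall>(s, t) \<in> ?S. MMap h \<cdot>\<^bsub>C\<^esub> s = MMap h \<cdot>\<^bsub>C\<^esub> t)
      \<longleftrightarrow> monoid_morphism D B (induced_mon D R N) (AMap R (MMap h) \<cdot>\<^bsub>D\<^esub> u)"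
    if h: "h \<in> Hom (Mon C) A N" for h N
  proof -
    have N: "monoid_in C N" and hN: "monoid_morphism C A N (MMap h)"
      and hh: "MMap h \<in> Hom C (MObj A) (MObj N)"
      using h by (auto simp: Mon_Hom monoid_morphism_def)
    let ?h = "AMap R (MMap h)" and ?RN = "induced_mon D R N"
    have RN: "monoid_in D ?RN" by (rule monoid_in_induced[OF N])
    interpret RN: monoid_object D ?RN by unfold_locales (rule RN)
    have RhN: "monoid_morphism D ?RA ?RN ?h" by (rule monoid_morphism_induced[OF A N hN])
    have [simp]: "?h \<in> Arr D" "Dom D ?h = OMap R (MObj A)" "Cod D ?h = OMap R (MObj N)"
      using AMap_Hom[OF hh] by (auto simp: Hom_def)
    have "?h \<cdot>\<^bsub>D\<^esub> t1 = convolution D ?RN (?h \<cdot>\<^bsub>D\<^esub> u) (?h \<cdot>\<^bsub>D\<^esub> u)"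
      unfolding t1_def by (rule D.monoid_morphism_convolution[OF RA RN RhN]) simp_all
    moreover have "?h \<cdot>\<^bsub>D\<^esub> t2 = MUnit ?RN"
      using RhN by (simp add: monoid_morphism_def t2_def)
    moreover have "?h \<cdot>\<^bsub>D\<^esub> s1 = (?h \<cdot>\<^bsub>D\<^esub> u) \<cdot>\<^bsub>D\<^esub> MMult B" "?h \<cdot>\<^bsub>D\<^esub> s2 = (?h \<cdot>\<^bsub>D\<^esub> u) \<cdot>\<^bsub>D\<^esub> MUnit B"
      by (simp_all add: s1_def s2_def D.Comp_assoc_Arr)
    ultimately show ?thesis
      using 1(3)[OF hh] 2(3)[OF hh]
      by (auto simp: monoid_morphism_def convolution_def Hom_def)
  qed
  have "\<exists>Q q. monoid_quotient C {(s2', t2')} A Q q"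
    by (rule C.monoid_quotient_pair[OF pres coeq A 2(1,2)])
  then obtain Q q where Q: "monoid_quotient C ?S A Q q"
    using C.monoid_quotient_insert[OF pres coeq A _ 1(1,2), of "{(s2', t2')}"] 2(1,2) by blast
  have q: "q \<in> Hom (Mon C) A Q" and qS: "\<forall>(s, t) \<in> ?S. MMap q \<cdot>\<^bsub>C\<^esub> s = MMap q \<cdot>\<^bsub>C\<^esub> t"
    and uq: "\<And>N h. h \<in> Hom (Mon C) A N \<Longrightarrow> \<forall>(s, t) \<in> ?S. MMap h \<cdot>\<^bsub>C\<^esub> s = MMap h \<cdot>\<^bsub>C\<^esub> t
      \<Longrightarrow> \<exists>!k. k \<in> Hom (Mon C) Q N \<and> k \<cdot>\<^bsub>Mon C\<^esub> q = h"
    using Q unfolding monoid_quotient_def by blast+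
  have MQ: "monoid_in C Q" and qm: "MMap q \<in> Hom C (MObj A) (MObj Q)"
    using q by (auto simp: Mon_Hom monoid_morphism_def)
  define w where "w = \<lparr>MSrc = B, MTgt = induced_mon D R Q, MMap = AMap R (MMap q) \<cdot>\<^bsub>D\<^esub> u\<rparr>"
  have w: "w \<in> Hom (Mon D) B (induced_mon D R Q)"
    using iff[OF q] qS B monoid_in_induced[OF MQ] by (simp add: Mon_Hom w_def)
  have "\<exists>!k. k \<in> Hom (Mon C) Q N \<and> AMap (induced_functor D R) k \<cdot>\<^bsub>Mon D\<^esub> w = f"
    if N: "monoid_in C N" and f: "f \<in> Hom (Mon D) B (induced_mon D R N)" for N f
  proof -
    have fm: "monoid_morphism D B (induced_mon D R N) (MMap f)"
      and fst: "MSrc f = B" "MTgt f = induced_mon D R N" using f by (auto simp: Mon_Hom)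
    have transpose: "AMap (induced_functor D R) k \<cdot>\<^bsub>Mon D\<^esub> w = f
        \<longleftrightarrow> AMap R (MMap (k \<cdot>\<^bsub>Mon C\<^esub> q)) \<cdot>\<^bsub>D\<^esub> u = MMap f"
      if k: "k \<in> Hom (Mon C) Q N" for k
    proof -
      have km: "MMap k \<in> Hom C (MObj Q) (MObj N)" and kN: "MTgt k = N"
        using k by (auto simp: Mon_Hom monoid_morphism_def)
      have "AMap R (MMap (k \<cdot>\<^bsub>Mon C\<^esub> q)) \<cdot>\<^bsub>D\<^esub> u
          = AMap R (MMap k) \<cdot>\<^bsub>D\<^esub> (AMap R (MMap q) \<cdot>\<^bsub>D\<^esub> u)"
        using AMap_Comp[OF qm km] D.Comp_assoc[OF u AMap_Hom[OF qm] AMap_Hom[OF km]] by simp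
      then show ?thesis
        using kN fst by (cases f) (simp add: induced_functor_def w_def)
    qed
    have "MMap f \<in> Hom D (MObj B) (OMap R (MObj N))" using fm by (simp add: monoid_morphism_def)
    from univ[OF N this] obtain h where h: "h \<in> Hom (Mon C) A N" "AMap R (MMap h) \<cdot>\<^bsub>D\<^esub> u = MMap f"
      and h_uniq: "\<And>h'. h' \<in> Hom (Mon C) A N \<Longrightarrow> AMap R (MMap h') \<cdot>\<^bsub>D\<^esub> u = MMap f \<Longrightarrow> h' = h"
      by (elim ex1E) blast
    have "\<forall>(s, t) \<in> ?S. MMap h \<cdot>\<^bsub>C\<^esub> s = MMap h \<cdot>\<^bsub>C\<^esub> t" using iff[OF h(1)] h(2) fm by metis
    from uq[OF h(1) this] obtain k where k: "k \<in> Hom (Mon C) Q N" "k \<cdot>\<^bsub>Mon C\<^esub> q = h"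
      and k_uniq: "\<And>k'. k' \<in> Hom (Mon C) Q N \<Longrightarrow> k' \<cdot>\<^bsub>Mon C\<^esub> q = h \<Longrightarrow> k' = k"
      by (elim ex1E) blast
    show ?thesis
    proof (intro ex1I conjI)
      show "k \<in> Hom (Mon C) Q N" by (rule k)
      show "AMap (induced_functor D R) k \<cdot>\<^bsub>Mon D\<^esub> w = f"
        unfolding transpose[OF k(1)] k(2) by (rule h(2))
      fix k' assume k': "k' \<in> Hom (Mon C) Q N \<and> AMap (induced_functor D R) k' \<cdot>\<^bsub>Mon D\<^esub> w = f"
      then have "k' \<cdot>\<^bsub>Mon C\<^esub> q = h"
        using h_uniq[OF MC.Comp_Hom[OF q]] transpose by blast
      then show "k' = k" using k_uniq k' by blast
    qed
  qed
  then have "universal_arrow (Mon C) (Mon D) (induced_functor D R) B Q w"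
    using MQ w by (simp add: universal_arrow_def induced_functor_def)
  then show ?thesis by blast
qed

theorem theorem11:
  fixes C :: "('o1, 'a1) monoidal" and D :: "('o2, 'a2) monoidal"
    and R :: "('o1, 'a1, 'o2, 'a2) lax_func"
    and L :: "('o2, 'a2, 'o1, 'a1) func"
    and T :: "('o1, 'a1, ('o1, 'a1) mon, ('o1, 'a1) mon_arr) func"
  assumes "monoidal_category C" and "monoidal_category D"
    and "lax_monoidal_functor C D R"
    and "is_left_adjoint C D L R"
    and "has_coequalizers C" and "tensor_preserves_coequalizers C"
    and "is_left_adjoint (Mon C) C T forgetful"
  shows "\<exists>Lbar :: (('o2, 'a2) mon, ('o2, 'a2) mon_arr, ('o1, 'a1) mon, ('o1, 'a1) mon_arr) func.
    is_left_adjoint (Mon C) (Mon D) Lbar (induced_functor D R)"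
proof -
  interpret lax_monoidal_functor C D R by (rule assms(3))
  have R: "\<exists>l v. universal_arrow C D R y l v" if "y \<in> Obj D" for y
  proof -
    obtain \<eta> \<epsilon> where "adjunction C D L R \<eta> \<epsilon>" using assms(4) unfolding is_left_adjoint_def by blast
    from adjunction.universal_arrow_unit[OF this that] show ?thesis by blast
  qed
  have U: "\<exists>A v. universal_arrow (Mon C) C forgetful x A v" if "x \<in> Obj C" for x
  proof -
    obtain \<eta> \<epsilon> where "adjunction (Mon C) C T forgetful \<eta> \<epsilon>"
      using assms(7) unfolding is_left_adjoint_def by blast
    from adjunction.universal_arrow_unit[OF this that] show ?thesis by blast
  qed
  show ?thesis
  proof (rule left_adjoint_if_universal_arrows[OF is_functor_induced])
    fix B assume "B \<in> Obj (Mon D)"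
    then show "\<exists>Q w. universal_arrow (Mon C) (Mon D) (induced_functor D R) B Q w"
      using universal_arrow_induced[OF assms(6,5) R U] by simp
  qed
qed

end
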